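(* Let $F$ be (the index expression of) a normalized matchgate signature of arity $n$ and let $\pi\in S_n$ be a permutation. If for all integers $1\le a<b<c<d\le n$, $$F_{\pi}(abcd)=F_{\pi}(ab)F_{\pi}(cd)-F_{\pi}(ac)F_{\pi}(bd)+F_{\pi}(ad)F_{\pi}(bc),$$ then $F_{\pi}$ is also a matchgate signature.
   Context: A signature of arity $n$ is a function $f:\{0,1\}^n\to\mathbb{C}$. A matchgate is a plane graph $G=(V,E)$ with edge weights $w:E\to\mathbb{C}$ and external nodes $U\subseteq V$ on its outer face labelled $1,\dots,|U|$ in clockwise order. Its signature $f$ has arity $|U|$ and, for $\alpha\in\{0,1\}^{|U|}$, $f(\alpha)=\#\mathrm{PM}(G-X)$, where $X\subseteq U$ consists of the external nodes whose label $i$ satisfies $\alpha_i=1$, and $\#\mathrm{PM}(G)=\sum_{M}\prod_{e\in M}w(e)$, the sum over all perfect matchings $M$ of $G$. A signature is a matchgate signature if it is the signature of some matchgate. A signature $f$ is normalized if $f(0\cdots0)=1$. Its index expression $F$ is defined, for distinct $b_1,\dots,b_k\in\{1,\dots,n\}$, by $F(b_1\dots b_k)=f(\alpha)$, where $\alpha_{b_1}=\dots=\alpha_{b_k}=1$ and all other bits of $\alpha$ are $0$ (so $F$ depends only on the set $\{b_1,\dots,b_k\}$, and $F()=1$). One identifies $f$ with $F$. For $\pi\in S_n$, $f_\pi$ denotes the signature obtained from $f$ by permuting variables by $\pi$, with index expression $F_\pi$ given by $F_\pi(b_1\dots b_k)=F(\pi(b_1)\dots\pi(b_k))$. *)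

theory Defs
  imports "HOL-Complex_Analysis.Complex_Analysis" "HOL-Combinatorics.Permutations"
begin

text \<open>Bit strings in \<open>{0,1}\<^sup>n\<close> are extensional functions \<open>\<alpha> \<in> {1..n} \<rightarrow>\<^sub>E UNIV\<close> with values in
  \<^typ>\<open>bool\<close>; the values of a signature of arity \<open>n\<close> at other arguments are irrelevant.\<close>

type_synonym signature = "(nat \<Rightarrow> bool) \<Rightarrow> complex"

text \<open>Vertices are points of the plane and edges are arcs, taken as point sets. Thus \<open>e \<inter> V\<close> is the
  set of the two end points of an edge \<open>e\<close>, and \<open>v \<in> e\<close> is incidence for a vertex \<open>v\<close>. Graphs are
  finite and simple: arcs have distinct end points, and distinct edges have distinct sets of end
  points.\<close>

definition plane_graph :: "complex set \<Rightarrow> complex set set \<Rightarrow> bool" where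
  "plane_graph V E \<longleftrightarrow>
     finite V \<and> finite E \<and>
     (\<forall>e\<in>E. \<exists>g. arc g \<and> path_image g = e \<and> e \<inter> V = {pathstart g, pathfinish g}) \<and>
     (\<forall>e\<in>E. \<forall>e'\<in>E. e \<noteq> e' \<longrightarrow> e \<inter> e' \<subseteq> V \<and> e \<inter> V \<noteq> e' \<inter> V)"

definition outer_face :: "complex set \<Rightarrow> complex set set \<Rightarrow> complex set" where
  "outer_face V E = outside (V \<union> \<Union>E)"

text \<open>The nodes \<open>u 1, \<dots>, u n\<close> lie in clockwise order around the outer face: some clockwise simple
  closed curve encloses the graph, runs through the outer face except at these nodes, and passes
  through them in this order. This makes sense also for disconnected graphs and for cut vertices,
  which occur several times on the boundary of the outer face.\<close>

definition clockwise_on_outer_face ::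
    "complex set \<Rightarrow> complex set set \<Rightarrow> nat \<Rightarrow> (nat \<Rightarrow> complex) \<Rightarrow> bool" where
  "clockwise_on_outer_face V E n u \<longleftrightarrow>
     (\<exists>\<gamma> t. simple_path \<gamma> \<and> pathfinish \<gamma> = pathstart \<gamma> \<and>
        (\<forall>z\<in>inside (path_image \<gamma>). winding_number \<gamma> z = -1) \<and>
        path_image \<gamma> \<subseteq> outer_face V E \<union> u ` {1..n} \<and>
        V \<union> \<Union>E \<subseteq> path_image \<gamma> \<union> inside (path_image \<gamma>) \<and>
        strict_mono_on {1..n} t \<and> t ` {1..n} \<subseteq> {0..<1} \<and> (\<forall>i\<in>{1..n}. \<gamma> (t i) = u i))"

definition matchgate :: "complex set \<Rightarrow> complex set set \<Rightarrow> nat \<Rightarrow> (nat \<Rightarrow> complex) \<Rightarrow> bool" where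
  "matchgate V E n u \<longleftrightarrow>
     plane_graph V E \<and> inj_on u {1..n} \<and> u ` {1..n} \<subseteq> V \<and>
     u ` {1..n} \<subseteq> frontier (outer_face V E) \<and> clockwise_on_outer_face V E n u"

definition perfect_matchings :: "complex set \<Rightarrow> complex set set \<Rightarrow> complex set set set" where
  "perfect_matchings V E = {M. M \<subseteq> E \<and> (\<forall>v\<in>V. \<exists>!e. e \<in> M \<and> v \<in> e)}"

definition PM :: "complex set \<Rightarrow> complex set set \<Rightarrow> (complex set \<Rightarrow> complex) \<Rightarrow> complex" where
  "PM V E w = (\<Sum>M\<in>perfect_matchings V E. \<Prod>e\<in>M. w e)"

definition matchgate_signature :: "nat \<Rightarrow> signature \<Rightarrow> bool" where
  "matchgate_signature n f \<longleftrightarrow>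
     (\<exists>V E w u. matchgate V E n u \<and>
        (\<forall>\<alpha> \<in> {1..n} \<rightarrow>\<^sub>E UNIV.
           let X = u ` {i \<in> {1..n}. \<alpha> i} in f \<alpha> = PM (V - X) {e \<in> E. e \<inter> X = {}} w))"

definition normalized :: "nat \<Rightarrow> signature \<Rightarrow> bool" where
  "normalized n f \<longleftrightarrow> f (\<lambda>i\<in>{1..n}. False) = 1"

definition index_expr :: "nat \<Rightarrow> signature \<Rightarrow> nat list \<Rightarrow> complex" where
  "index_expr n f bs = f (\<lambda>i\<in>{1..n}. i \<in> set bs)"

text \<open>The inverse of \<open>\<pi>\<close> is what makes the index expression of the permuted signature
  \<open>F\<^sub>\<pi>(b\<^sub>1 \<dots> b\<^sub>k) = F(\<pi>(b\<^sub>1) \<dots> \<pi>(b\<^sub>k))\<close>; see the lemma below.\<close>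

definition permute_signature :: "(nat \<Rightarrow> nat) \<Rightarrow> signature \<Rightarrow> signature" where
  "permute_signature \<pi> f \<alpha> = f (\<alpha> \<circ> inv \<pi>)"

lemma index_expr_permute_signature:
  assumes "\<pi> permutes {1..n}"
  shows "index_expr n (permute_signature \<pi> f) bs = index_expr n f (map \<pi> bs)"
proof -
  have "(\<lambda>i\<in>{1..n}. i \<in> set bs) \<circ> inv \<pi> = (\<lambda>i\<in>{1..n}. i \<in> set (map \<pi> bs))"
  proof
    fix j
    have "inv \<pi> j \<in> {1..n} \<longleftrightarrow> j \<in> {1..n}"
      using permutes_in_image[OF permutes_inv[OF assms]] .
    moreover have "inv \<pi> j \<in> set bs \<longleftrightarrow> j \<in> \<pi> ` set bs"
      using permutes_inverses[OF assms] by (metis imageE imageI)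
    ultimately show "((\<lambda>i\<in>{1..n}. i \<in> set bs) \<circ> inv \<pi>) j = (\<lambda>i\<in>{1..n}. i \<in> set (map \<pi> bs)) j"
      by (simp only: comp_def restrict_def set_map)
  qed
  then show ?thesis
    by (simp only: index_expr_def permute_signature_def)
qed

end

theory Submission imports Defs begin

text \<open>For a set \<open>S\<close> of labels write \<open>F S\<close> for the value of a signature at the indicator of \<open>S\<close>. Superposing
  two matchings and using that disjoint paths in a disc do not cross, the signature of a matchgate
  satisfies the matchgate identities for the order of its nodes; if \<open>F {} = 1\<close>, they contain the Pfaffian
  expansion of \<open>F S\<close> along any element of \<open>S\<close>. Conversely, every table of pair values \<open>F {a,b}\<close> is
  realised by a planar grid, built by row operations. So \<open>F\<^sub>\<pi>\<close>, which satisfies the identities for the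
  order \<open>\<pi>\<close>, is to be compared with a matchgate signature \<open>G\<close> with the same pair values, which satisfies
  them for the usual order. By hypothesis they agree on sets of size \<open>4\<close> as well. If they agree on all
  smaller sets and \<open>card S = 2k\<close> with \<open>k\<close> odd, a signed sum of the expansions along all elements of \<open>S\<close>
  yields \<open>F\<^sub>\<pi> S = G S\<close>; if \<open>k \<ge> 4\<close> is even, pinning a pair of labels with nonzero value reduces the
  claim to \<open>k - 1\<close>.\<close>

section \<open>Signatures satisfying the matchgate identities\<close>

text \<open>The expansions of \<open>F\<^sub>\<pi>\<close> and \<open>G\<close> along one label
  contain the same products of smaller values, but with signs from two different orders, so they
  cannot be compared term by term. Only the sum over all labels of \<open>S\<close> cancels the
  difference. It says that \<open>F\<^sub>\<pi> S - G S\<close> times a sum of \<open>2k\<close>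
  signs is 0. These signs have product 1, so their sum is \<open>2k - 2m\<close> with
  \<open>m\<close> even: never 0 for odd \<open>k\<close>, but possibly 0 for even \<open>k\<close>.
  Pinning lowers an even \<open>k\<close> to the odd \<open>k - 1\<close>; for \<open>k = 2\<close>
  only a single pair remains, whose expansion is a tautology, which is why size 4 is left to the
  hypothesis. Pinning is also the reason for carrying the whole family of identities and not just
  the expansions: the family survives fixing a set of labels to 1, with \<open>F P\<close> as the
  new normalization. The order is a parameter \<open>r\<close>, as permuting the variables changes
  nothing else in the identities. In the converse direction it is enough to realise pair values,
  since all further values of \<open>G\<close> are forced by its expansions.\<close>

definition matchgate_identities :: "('a \<Rightarrow> nat) \<Rightarrow> 'a set \<Rightarrow> ('a set \<Rightarrow> complex) \<Rightarrow> bool" where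
  "matchgate_identities r U F \<longleftrightarrow>
     (\<forall>A B. A \<subseteq> U \<longrightarrow> B \<subseteq> U \<longrightarrow>
        (\<Sum>i\<in>sym_diff A B. (-1) ^ card {k \<in> sym_diff A B. r k < r i}
            * F (sym_diff A {i}) * F (sym_diff B {i})) = 0)"

definition rank_sign :: "('a \<Rightarrow> nat) \<Rightarrow> 'a set \<Rightarrow> 'a \<Rightarrow> complex" where
  "rank_sign r S i = (-1) ^ card {k \<in> S. r k < r i}"

lemma rank_sign_square [simp]: "rank_sign r S i * rank_sign r S i = 1"
  by (simp add: rank_sign_def flip: power_add mult_2)

lemma rank_sign_cases: "rank_sign r S i = 1 \<or> rank_sign r S i = -1"
  unfolding rank_sign_def by (cases "even (card {k \<in> S. r k < r i})") auto

text \<open>Take the identity for \<open>A = {x}\<close> and \<open>B = S - {x}\<close>, whose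
  symmetric difference is \<open>S\<close>. The term of \<open>x\<close> is
  \<open>F {} * F S\<close> up to sign, and every other label \<open>i\<close> contributes
  \<open>F {x,i} * F (S - {x,i})\<close>; multiplying by the sign of \<open>x\<close> isolates
  \<open>F S\<close>.\<close>

lemma pfaffian_expansion:
  assumes F: "matchgate_identities r U F" "F {} = 1" and S: "S \<subseteq> U" "finite S" "x \<in> S"
  shows "F S = - (\<Sum>i\<in>S - {x}. rank_sign r S x * rank_sign r S i * (F {x,i} * F (S - {x,i})))"
proof -
  have D: "sym_diff {x} (S - {x}) = S"
    using S by auto
  have "(\<Sum>i\<in>S. (-1) ^ card {k \<in> S. r k < r i}
            * F (sym_diff {x} {i}) * F (sym_diff (S - {x}) {i})) = 0"
    using F(1)[unfolded matchgate_identities_def, rule_format, of "{x}" "S - {x}"] S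
    unfolding D by blast
  moreover have "sym_diff (S - {x}) {x} = S" "sym_diff {x} {x} = {}"
    using S by auto
  ultimately have "rank_sign r S x * F S
      + (\<Sum>i\<in>S - {x}. rank_sign r S i * F (sym_diff {x} {i}) * F (sym_diff (S - {x}) {i})) = 0"
    unfolding rank_sign_def[symmetric] using F(2)
    by (simp only: sum.remove[OF S(2,3)] mult_1_right)
  also have "(\<Sum>i\<in>S - {x}. rank_sign r S i * F (sym_diff {x} {i}) * F (sym_diff (S - {x}) {i}))
      = (\<Sum>i\<in>S - {x}. rank_sign r S i * (F {x,i} * F (S - {x,i})))"
  proof (rule sum.cong[OF refl])
    fix i assume "i \<in> S - {x}"
    then have "sym_diff {x} {i} = {x,i}" "sym_diff (S - {x}) {i} = S - {x,i}"
      by auto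
    then show "rank_sign r S i * F (sym_diff {x} {i}) * F (sym_diff (S - {x}) {i})
        = rank_sign r S i * (F {x,i} * F (S - {x,i}))" by simp
  qed
  finally have 0: "rank_sign r S x * F S
      + (\<Sum>i\<in>S - {x}. rank_sign r S i * (F {x,i} * F (S - {x,i}))) = 0" .
  have "F S + (\<Sum>i\<in>S - {x}. rank_sign r S x * rank_sign r S i * (F {x,i} * F (S - {x,i})))
      = (rank_sign r S x * rank_sign r S x) * F S
        + rank_sign r S x * (\<Sum>i\<in>S - {x}. rank_sign r S i * (F {x,i} * F (S - {x,i})))"
    by (simp only: rank_sign_square mult_1_left sum_distrib_left mult.assoc)
  also have "\<dots> = rank_sign r S x * 0"
    unfolding 0[symmetric] by (simp only: distrib_left mult.assoc)
  finally have "F S + (\<Sum>i\<in>S - {x}. rank_sign r S x * rank_sign r S i * (F {x,i} * F (S - {x,i}))) = 0"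
    by simp
  then show ?thesis by (simp add: eq_neg_iff_add_eq_0)
qed

text \<open>Every term of the expansion contains a value at an odd set with two labels fewer; for a
  singleton the sum is empty.\<close>

lemma odd_set_zero:
  assumes F: "matchgate_identities r U F" "F {} = 1" and S: "S \<subseteq> U" "finite S" "odd (card S)"
  shows "F S = 0"
  using S
proof (induction "card S" arbitrary: S rule: less_induct)
  case less
  then obtain x where x: "x \<in> S" by fastforce
  have "F (S - {x,i}) = 0" if "i \<in> S - {x}" for i
  proof -
    have "card (S - {x,i}) = card S - 2"
      using that x less.prems by (subst card_Diff_subset) auto
    moreover have "card {x,i} \<le> card S"
      using that x less.prems by (intro card_mono) auto
    then have "card S \<ge> 2" using that by auto
    ultimately show ?thesis
      using less.hyps[of "S - {x,i}"] less.prems by auto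
  qed
  then show ?case
    using pfaffian_expansion[OF F less.prems(1,2) x] by simp
qed

text \<open>The product of all signs of ranks depends on the cardinality only, since the ranks run
  through \<open>0, \<dots>, card S - 1\<close>.\<close>

lemma prod_rank_sign:
  assumes "finite S" "inj_on r S"
  shows "(\<Prod>i\<in>S. rank_sign r S i) = (-1) ^ (\<Sum>k<card S. k)"
  using assms
proof (induction "card S" arbitrary: S)
  case 0
  then show ?case by simp
next
  case (Suc m)
  have "r ` S \<noteq> {}" "finite (r ` S)" using Suc by auto
  then have "Max (r ` S) \<in> r ` S" "\<forall>y\<in>S. r y \<le> Max (r ` S)" by auto
  then obtain x where x: "x \<in> S" "\<And>y. y \<in> S \<Longrightarrow> r y \<le> r x" by auto
  have lt: "r y < r x" if "y \<in> S - {x}" for y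
    using x that Suc.prems(2) by (metis DiffE inj_onD insertCI order_le_less)
  have m: "card (S - {x}) = m" using x Suc by simp
  have "(\<Prod>i\<in>S. rank_sign r S i) = rank_sign r S x * (\<Prod>i\<in>S - {x}. rank_sign r S i)"
    using x Suc.prems by (simp add: prod.remove)
  also have "{k \<in> S. r k < r x} = S - {x}" using lt by auto
  then have "rank_sign r S x = (-1) ^ m" using m by (simp add: rank_sign_def)
  also have "(\<Prod>i\<in>S - {x}. rank_sign r S i) = (\<Prod>i\<in>S - {x}. rank_sign r (S - {x}) i)"
  proof (rule prod.cong[OF refl])
    fix i assume "i \<in> S - {x}"
    then have "{k \<in> S. r k < r i} = {k \<in> S - {x}. r k < r i}"
      using lt[of i] by auto
    then show "rank_sign r S i = rank_sign r (S - {x}) i" by (simp add: rank_sign_def)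
  qed
  also have "\<dots> = (-1) ^ (\<Sum>k<card (S - {x}). k)"
    using Suc m by (intro Suc.hyps(1)) (auto intro: inj_on_subset)
  finally show ?case
    using m unfolding Suc.hyps(2)[symmetric] by (simp add: power_add)
qed

text \<open>The witness \<open>m\<close> is the number of negative signs; it ties the sum of the
  signs to their product.\<close>

lemma prod_signs:
  fixes s :: "'a \<Rightarrow> complex"
  assumes "finite S" "\<And>i. i \<in> S \<Longrightarrow> s i = 1 \<or> s i = -1"
  shows "\<exists>m. prod s S = (-1) ^ m \<and> sum s S = of_nat (card S) - 2 * of_nat m"
  using assms
proof (induction S rule: finite_induct)
  case empty
  then show ?case by auto
next
  case (insert x S)
  then obtain m where m: "prod s S = (-1) ^ m"
      "sum s S = of_nat (card S) - 2 * of_nat m" by auto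
  from insert.prems[of x] consider "s x = 1" | "s x = -1" by auto
  then show ?case
  proof cases
    case 1
    then show ?thesis using m insert.hyps by (intro exI[of _ m]) auto
  next
    case 2
    then show ?thesis using m insert.hyps by (intro exI[of _ "Suc m"]) auto
  qed
qed

text \<open>With \<open>s = rank_sign r S \<cdot> rank_sign q S\<close>, summing the expansions along all \<open>x \<in> S\<close> with weights
  \<open>s x\<close> makes the difference of the right hand sides antisymmetric in the two indices, so it
  vanishes; and \<open>\<Sum>s \<noteq> 0\<close> because \<open>\<Prod>s = 1\<close> while \<open>card S / 2\<close> is odd.\<close>

lemma agree_twice_odd:
  assumes F: "matchgate_identities r U F" "F {} = 1" and G: "matchgate_identities q U G" "G {} = 1"
    and S: "S \<subseteq> U" "finite S" "inj_on r S" "inj_on q S" "card S = 2 * k" "odd k"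
    and eq: "\<And>T. T \<subset> S \<Longrightarrow> card T \<le> 2 \<or> card T = card S - 2 \<Longrightarrow> F T = G T"
    and k: "k \<noteq> 1"
  shows "F S = G S"
proof -
  define P where "P = rank_sign r S"
  define Q where "Q = rank_sign q S"
  define s where "s x = P x * Q x" for x
  define Y where "Y x i = F {x,i} * F (S - {x,i})" for x i
  have PP: "P x * P x = 1" "Q x * Q x = 1" for x by (simp_all add: P_def Q_def)
  \<comment> \<open>Since \<open>k\<close> is odd and not 1, a pair and its complement in
    \<open>S\<close> are proper subsets, so \<open>F\<close> and \<open>G\<close> agree on
    both.\<close>
  have card2: "card S > 2" using k S by (cases k) auto
  have YG: "G {x,i} * G (S - {x,i}) = Y x i" if "x \<in> S" "i \<in> S - {x}" for x i
  proof -
    have c: "card {x,i} = 2" using that by auto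
    have "card (S - {x,i}) = card S - 2"
      using that S c by (subst card_Diff_subset) auto
    moreover have "{x,i} \<noteq> S" using c card2 by auto
    ultimately show ?thesis unfolding Y_def
      using eq[of "{x,i}"] eq[of "S - {x,i}"] that c by (metis Diff_iff Diff_subset insertCI
          insert_subset order.refl psubsetI empty_subsetI)
  qed
  have 1: "F S = - (\<Sum>i\<in>S - {x}. P x * P i * Y x i)" if "x \<in> S" for x
    using pfaffian_expansion[OF F S(1,2) that] by (simp add: P_def Y_def)
  have 2: "G S = - (\<Sum>i\<in>S - {x}. Q x * Q i * Y x i)" if "x \<in> S" for x
    using pfaffian_expansion[OF G S(1,2) that] YG[OF that] by (simp add: Q_def)
  define Z where "Z x i = (if i = x then 0 else P x * P i * (s x - s i) * Y x i)" for x i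
  have 3: "s x * (F S - G S) = - (\<Sum>i\<in>S. Z x i)" if "x \<in> S" for x
  proof -
    have "s x * (F S - G S) = - (\<Sum>i\<in>S - {x}. s x * (P x * P i * Y x i - Q x * Q i * Y x i))"
      by (subst 1[OF that], subst 2[OF that]) (simp add: sum_subtractf sum_distrib_left right_diff_distrib)
    also have "(\<Sum>i\<in>S - {x}. s x * (P x * P i * Y x i - Q x * Q i * Y x i)) = (\<Sum>i\<in>S - {x}. Z x i)"
    proof (rule sum.cong[OF refl])
      fix i assume i: "i \<in> S - {x}"
      \<comment> \<open>Both sides equal \<open>P x * Q i\<close>, because squares of signs are 1.
        This expresses the signs of the second expansion by those of the first and leaves the factor
        \<open>s x - s i\<close>.\<close>
      have "s x * (Q x * Q i) = P x * P i * s i"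
      proof -
        have "s x * (Q x * Q i) = P x * (Q x * Q x) * Q i" by (simp add: s_def)
        also have "\<dots> = P x * (P i * P i) * Q i" by (simp only: PP)
        finally show ?thesis by (simp add: s_def)
      qed
      then have "s x * (P x * P i * Y x i - Q x * Q i * Y x i) = P x * P i * (s x - s i) * Y x i"
        by (simp add: algebra_simps)
      then show "s x * (P x * P i * Y x i - Q x * Q i * Y x i) = Z x i"
        using i by (simp add: Z_def)
    qed
    also have "\<dots> = (\<Sum>i\<in>S. Z x i)"
      using S(2) that by (subst (2) sum.remove[of _ x]) (auto simp: Z_def)
    finally show ?thesis .
  qed
  have "(\<Sum>x\<in>S. \<Sum>i\<in>S. Z x i) = (\<Sum>x\<in>S. \<Sum>i\<in>S. Z i x)"
    by (rule sum.swap)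
  also have "\<dots> = - (\<Sum>x\<in>S. \<Sum>i\<in>S. Z x i)"
  proof -
    have "Z i x = - Z x i" for i x
      by (simp add: Z_def Y_def insert_commute algebra_simps)
    then have "(\<Sum>x\<in>S. \<Sum>i\<in>S. Z i x) = (\<Sum>x\<in>S. \<Sum>i\<in>S. - Z x i)"
      by (intro sum.cong refl)
    then show ?thesis by (simp only: sum_negf)
  qed
  finally have "(\<Sum>x\<in>S. \<Sum>i\<in>S. Z x i) = 0" by simp
  then have "sum s S * (F S - G S) = 0"
    using 3 by (simp add: sum_distrib_right sum_negf)
  moreover have "sum s S \<noteq> 0"
  proof
    \<comment> \<open>A zero sum would make exactly \<open>k\<close> of the \<open>2k\<close> signs
      negative and hence their product \<open>(-1) ^ k = -1\<close>, against the product 1 obtained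
      from the ranks.\<close>
    assume 0: "sum s S = 0"
    have "s i = 1 \<or> s i = -1" for i
      using rank_sign_cases[of r S i] rank_sign_cases[of q S i] by (auto simp: s_def P_def Q_def)
    with prod_signs[OF S(2), of s] obtain m where
      m: "prod s S = (-1) ^ m" "sum s S = of_nat (card S) - 2 * of_nat m" by blast
    then have "of_nat (2 * k) = (of_nat (2 * m) :: complex)" using 0 S(5) by simp
    then have "m = k" by (simp only: of_nat_eq_iff)
    then have "prod s S = -1" using m S(6) by simp
    moreover have "prod s S = 1"
      unfolding s_def P_def Q_def prod.distrib
      using prod_rank_sign[OF S(2,3)] prod_rank_sign[OF S(2,4)] by (simp flip: power_add mult_2)
    ultimately show False by simp
  qed
  ultimately show ?thesis by simp
qed

text \<open>Adding \<open>P\<close> to both \<open>A\<close> and \<open>B\<close> leaves their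
  symmetric difference unchanged, so this is the identity for \<open>A \<union> P\<close> and
  \<open>B \<union> P\<close>, divided by the square of \<open>F P\<close>.\<close>

lemma matchgate_identities_pin:
  assumes "matchgate_identities r U F" "P \<subseteq> U"
  shows "matchgate_identities r (U - P) (\<lambda>T. F (T \<union> P) / F P)"
  unfolding matchgate_identities_def
proof (intro allI impI)
  fix A B assume AB: "A \<subseteq> U - P" "B \<subseteq> U - P"
  define D where "D = sym_diff A B"
  have D: "sym_diff (A \<union> P) (B \<union> P) = D" using AB by (auto simp: D_def)
  have "(\<Sum>i\<in>D. (-1) ^ card {k \<in> D. r k < r i}
            * F (sym_diff (A \<union> P) {i}) * F (sym_diff (B \<union> P) {i})) = 0"
    using assms(1)[unfolded matchgate_identities_def, rule_format, of "A \<union> P" "B \<union> P"] assms(2) AB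
    unfolding D by blast
  moreover have "(-1) ^ card {k \<in> D. r k < r i} * (F (sym_diff A {i} \<union> P) / F P)
        * (F (sym_diff B {i} \<union> P) / F P)
      = (1 / (F P)\<^sup>2) * ((-1) ^ card {k \<in> D. r k < r i}
            * F (sym_diff (A \<union> P) {i}) * F (sym_diff (B \<union> P) {i}))" if "i \<in> D" for i
  proof -
    have "i \<notin> P" using that AB by (auto simp: D_def)
    then have "sym_diff A {i} \<union> P = sym_diff (A \<union> P) {i}"
      "sym_diff B {i} \<union> P = sym_diff (B \<union> P) {i}" by auto
    then show ?thesis by (simp add: power2_eq_square)
  qed
  ultimately show "(\<Sum>i\<in>sym_diff A B. (-1) ^ card {k \<in> sym_diff A B. r k < r i}
        * (F (sym_diff A {i} \<union> P) / F P) * (F (sym_diff B {i} \<union> P) / F P)) = 0"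
    unfolding D_def[symmetric] by (simp flip: sum_distrib_left sum_divide_distrib)
qed

lemma agree_on_all_sets:
  assumes F: "matchgate_identities r U F" "F {} = 1" and G: "matchgate_identities q U G" "G {} = 1"
    and U: "finite U" "inj_on r U" "inj_on q U"
    and eq: "\<And>T. T \<subseteq> U \<Longrightarrow> card T = 2 \<or> card T = 4 \<Longrightarrow> F T = G T"
  shows "S \<subseteq> U \<Longrightarrow> F S = G S"
proof (induction "card S" arbitrary: S rule: less_induct)
  case less
  have finS: "finite S" using less.prems U finite_subset by blast
  have inj: "inj_on r S" "inj_on q S" using less.prems U inj_on_subset by blast+
  have smaller: "F T = G T" if "T \<subset> S" for T
    using less.hyps[of T] less.prems that finS psubset_card_mono by blast
  show ?case
  proof (cases "odd (card S)")
    case True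
    then show ?thesis using odd_set_zero F G less.prems finS by metis
  next
    case even: False
    then obtain k where k: "card S = 2 * k" by auto
    have "k = 0 \<or> k = 1 \<or> k = 2 \<or> (odd k \<and> k \<noteq> 1) \<or> (even k \<and> k \<ge> 4)"
      by presburger
    then consider "k = 0" | "k = 1" | "k = 2" | "odd k" "k \<noteq> 1" | "even k" "k \<ge> 4"
      by blast
    then show ?thesis
    proof cases
      case 1
      then show ?thesis using k finS F G by auto
    next
      case 2
      then show ?thesis using k eq less.prems by auto
    next
      case 3
      then show ?thesis using k eq less.prems by auto
    next
      case 4
      show ?thesis
        using agree_twice_odd[OF F G less.prems finS inj k 4(1) _ 4(2)] smaller by blast
    next
      case 5
      show ?thesis
      proof (cases "\<exists>x\<in>S. \<exists>j\<in>S - {x}. F {x,j} \<noteq> 0")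
        \<comment> \<open>If no pair in \<open>S\<close> has a nonzero value, there is nothing to
          pin, but then both expansions consist of zero terms.\<close>
        case False
        obtain x where x: "x \<in> S" using k 5 by fastforce
        have "F {x,j} = 0" "G {x,j} = 0" if "j \<in> S - {x}" for j
        proof -
          show 0: "F {x,j} = 0" using False x that by blast
          have "F {x,j} = G {x,j}" using eq[of "{x,j}"] x that less.prems(1) by (metis DiffE card_2_iff insertCI insert_subset
                empty_subsetI subset_iff)
          then show "G {x,j} = 0" using 0 by simp
        qed
        then show ?thesis
          using pfaffian_expansion[OF F less.prems finS x] pfaffian_expansion[OF G less.prems finS x]
          by simp
      next
        case True
        then obtain x j where xj: "x \<in> S" "j \<in> S" "j \<noteq> x" "F {x,j} \<noteq> 0" by auto
        define P where "P = {x,j}"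
        have P: "P \<subseteq> U" "F P \<noteq> 0" "F P = G P" "card P = 2" "P \<subseteq> S" "finite P"
          using xj less.prems(1) finS eq[of "{x,j}"] by (simp_all add: P_def subset_iff)
        have c: "card (S - P) = 2 * (k - 1)"
          using P k by (simp add: card_Diff_subset)
        \<comment> \<open>For a proper subset \<open>T\<close> of \<open>S - P\<close> the set
          \<open>T \<union> P\<close> is a proper subset of \<open>S\<close>, so the pinned
          signatures agree at \<open>T\<close> by induction. As \<open>F P = G P\<close> is nonzero,
          it can be cancelled at the end.\<close>
        have "F (S - P \<union> P) / F P = G (S - P \<union> P) / G P"
        proof (rule agree_twice_odd[where k = "k - 1" and U = "U - P" and r = r and q = q
              and F = "\<lambda>T. F (T \<union> P) / F P" and G = "\<lambda>T. G (T \<union> P) / G P"])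
          show "matchgate_identities r (U - P) (\<lambda>T. F (T \<union> P) / F P)"
            "matchgate_identities q (U - P) (\<lambda>T. G (T \<union> P) / G P)"
            using matchgate_identities_pin F(1) G(1) P(1) by blast+
          show "F ({} \<union> P) / F P = 1" "G ({} \<union> P) / G P = 1" using P by auto
          show "S - P \<subseteq> U - P" using less.prems by auto
          show "finite (S - P)" using finS by auto
          show "inj_on r (S - P)" "inj_on q (S - P)" using inj inj_on_subset by blast+
          show "card (S - P) = 2 * (k - 1)" by (fact c)
          show "odd (k - 1)" using 5 by auto
          show "k - 1 \<noteq> 1" using 5 by auto
          fix T assume "T \<subset> S - P"
          then have "T \<union> P \<subset> S" using P by blast
          then show "F (T \<union> P) / F P = G (T \<union> P) / G P" using smaller P by simp
        qed
        then show ?thesis using P by (simp add: Un_absorb2)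
      qed
    qed
  qed
qed

section \<open>Superposition of matchings\<close>

lemma even_card_involution:
  assumes "finite A" "\<And>x. x \<in> A \<Longrightarrow> t x \<in> A" "\<And>x. x \<in> A \<Longrightarrow> t x \<noteq> x" "\<And>x. x \<in> A \<Longrightarrow> t (t x) = x"
  shows "even (card A)"
  using assms
proof (induction "card A" arbitrary: A rule: less_induct)
  case less
  show ?case
  proof (cases "A = {}")
    case False
    then obtain x where x: "x \<in> A" by blast
    have s: "{x, t x} \<subseteq> A" "card {x, t x} = 2"
      using x less.prems(2)[OF x] less.prems(3)[OF x] by auto
    then have c: "card (A - {x, t x}) = card A - 2" "card A \<ge> 2"
      using less.prems(1) card_mono[of A "{x, t x}"] by (simp_all add: card_Diff_subset)
    have "even (card (A - {x, t x}))"
    proof (rule less.hyps)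
      show "card (A - {x, t x}) < card A" using c by linarith
      fix y assume y: "y \<in> A - {x, t x}"
      then show "t y \<in> A - {x, t x}"
        using less.prems(2,4) x by (metis Diff_iff insert_iff singletonD)
    qed (use less.prems in auto)
    then show ?thesis using c by auto
  qed auto
qed

text \<open>No pair leaves the interval between \<open>i\<close> and \<open>t i\<close>, so the
  labels strictly inside are paired with each other and their number is even. Hence the ranks of
  \<open>i\<close> and \<open>t i\<close> differ by an odd number.\<close>

lemma noncrossing_pairing_sign:
  fixes D :: "nat set"
  assumes "finite D" and t: "\<And>x. x \<in> D \<Longrightarrow> t x \<in> D" "\<And>x. x \<in> D \<Longrightarrow> t x \<noteq> x" "\<And>x. x \<in> D \<Longrightarrow> t (t x) = x"
    and nc: "\<And>i j. i \<in> D \<Longrightarrow> j \<in> D \<Longrightarrow> i < j \<Longrightarrow> j < t i \<Longrightarrow> t i < t j \<Longrightarrow> False"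
    and i: "i \<in> D"
  shows "(-1) ^ card {k \<in> D. k < t i} = - ((-1) ^ card {k \<in> D. k < i} :: complex)"
proof -
  have *: "(-1) ^ card {k \<in> D. k < t i} = - ((-1) ^ card {k \<in> D. k < i} :: complex)"
    if i: "i \<in> D" "i < t i" for i
  proof -
    define B where "B = {k \<in> D. i < k \<and> k < t i}"
    have "even (card B)"
    proof (rule even_card_involution)
      show "finite B" using assms(1) by (simp add: B_def)
      fix j assume j: "j \<in> B"
      then have jD: "j \<in> D" by (simp add: B_def)
      show "t j \<noteq> j" "t (t j) = j" using t jD by auto
      have "t j \<noteq> i" "t j \<noteq> t i" using t i j unfolding B_def by (metis (lifting) mem_Collect_eq nat_neq_iff)+
      moreover have "\<not> t j < i"
      proof
        assume "t j < i"
        then show False using nc[of "t j" i] t jD i j by (auto simp: B_def)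
      qed
      moreover have "\<not> t i < t j" using nc[of i j] i j by (auto simp: B_def)
      ultimately show "t j \<in> B" using t(1)[OF jD] by (auto simp: B_def)
    qed
    moreover have "{k \<in> D. k < t i} = insert i ({k \<in> D. k < i} \<union> B)"
      using i by (auto simp: B_def)
    moreover have "card (insert i ({k \<in> D. k < i} \<union> B)) = Suc (card {k \<in> D. k < i} + card B)"
    proof -
      have "card (insert i ({k \<in> D. k < i} \<union> B)) = Suc (card ({k \<in> D. k < i} \<union> B))"
        using assms(1) by (intro card_insert_disjoint) (auto simp: B_def)
      also have "card ({k \<in> D. k < i} \<union> B) = card {k \<in> D. k < i} + card B"
        using assms(1) by (intro card_Un_disjoint) (auto simp: B_def)
      finally show ?thesis .
    qed
    ultimately show ?thesis by (simp add: power_add)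
  qed
  show ?thesis
  proof (cases "i < t i")
    case True
    then show ?thesis using * i by blast
  next
    case False
    then have "t i < t (t i)" using t i by (metis nat_neq_iff)
    then show ?thesis using *[of "t i"] t i by simp
  qed
qed

text \<open>Here \<open>m\<close> and \<open>n\<close> stand for two matchings and their fixed
  points for unmatched vertices. From \<open>x\<close>, which is fixed by \<open>n\<close> only, the
  walk applying \<open>m\<close> and \<open>n\<close> in turn cannot return, so it ends at a second
  vertex fixed by exactly one of them.\<close>

lemma involution_component:
  fixes m n :: "'a \<Rightarrow> 'a"
  assumes "finite V" and m: "\<And>v. v \<in> V \<Longrightarrow> m v \<in> V" "\<And>v. v \<in> V \<Longrightarrow> m (m v) = v"
    and n: "\<And>v. v \<in> V \<Longrightarrow> n v \<in> V" "\<And>v. v \<in> V \<Longrightarrow> n (n v) = v"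
    and x: "x \<in> V" "n x = x" "m x \<noteq> x"
  shows "\<exists>C y. C \<subseteq> V \<and> x \<in> C \<and> y \<in> C \<and> y \<noteq> x \<and> (\<forall>z\<in>C. m z \<in> C \<and> n z \<in> C)
    \<and> (\<forall>z\<in>C. (m z = z) \<noteq> (n z = z) \<longleftrightarrow> z = x \<or> z = y)
    \<and> (\<forall>z\<in>C. (x, z) \<in> {(v,w). w = m v \<or> w = n v}\<^sup>*)"
  using assms
proof (induction "card V" arbitrary: V m n x rule: less_induct)
  case less
  define x1 where "x1 = m x"
  have x1: "x1 \<in> V" "m x1 = x" "x1 \<noteq> x" using less.prems by (auto simp: x1_def)
  let ?R = "{(v,w). w = m v \<or> w = n v}"
  have step: "(x, x1) \<in> ?R\<^sup>*" by (intro r_into_rtrancl) (simp add: x1_def)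
  show ?case
  proof (cases "n x1 = x1")
    case True
    show ?thesis
      by (rule exI[of _ "{x, x1}"], rule exI[of _ x1])
        (use True x1 less.prems step in \<open>auto simp: x1_def[symmetric]\<close>)
  next
    case False
    \<comment> \<open>When \<open>x\<close> is deleted, its partner \<open>x1\<close> loses its mate
      under \<open>m\<close> and becomes a fixed point. It starts the shorter walk, with the roles
      of the two involutions exchanged.\<close>
    define m' where "m' = m(x1 := x1)"
    have m': "m' z = m z" if "z \<noteq> x1" for z using that by (simp add: m'_def)
    have m'1: "m' x1 = x1" by (simp add: m'_def)
    have cl: "m' v \<in> V - {x}" "m' (m' v) = v" "n v \<in> V - {x}" "n (n v) = v" if "v \<in> V - {x}" for v
    proof -
      have v: "v \<in> V" "v \<noteq> x" using that by auto
      show "n (n v) = v" using less.prems v by auto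
      show "n v \<in> V - {x}" using less.prems v by (metis Diff_iff singletonD)
      have *: "m v \<noteq> x" "m v \<noteq> x1" if "v \<noteq> x1"
        using that v less.prems x1 by metis+
      show "m' v \<in> V - {x}" using * v x1 less.prems by (auto simp: m'_def)
      show "m' (m' v) = v" using * v less.prems by (auto simp: m'_def)
    qed
    have "card (V - {x}) < card V"
      using less.prems by (intro psubset_card_mono) auto
    from less.hyps[OF this, of n m' x1] obtain C y where
      C: "C \<subseteq> V - {x}" "x1 \<in> C" "y \<in> C" "y \<noteq> x1" "\<And>z. z \<in> C \<Longrightarrow> n z \<in> C \<and> m' z \<in> C"
        "\<And>z. z \<in> C \<Longrightarrow> (n z = z) \<noteq> (m' z = z) \<longleftrightarrow> z = x1 \<or> z = y"
        "\<And>z. z \<in> C \<Longrightarrow> (x1, z) \<in> {(v,w). w = n v \<or> w = m' v}\<^sup>*"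
      using cl x1 m'1 False less.prems(1) by auto
    have "{(v,w). w = n v \<or> w = m' v} \<subseteq> ?R\<^sup>*"
      by (auto simp: m'_def split: if_splits)
    then have sub: "{(v,w). w = n v \<or> w = m' v}\<^sup>* \<subseteq> ?R\<^sup>*"
      by (rule rtrancl_subset_rtrancl)
    show ?thesis
    proof (intro exI conjI ballI)
      show "insert x C \<subseteq> V" "x \<in> insert x C" "y \<in> insert x C" "y \<noteq> x"
        using C less.prems by auto
      fix z assume z: "z \<in> insert x C"
      show "m z \<in> insert x C"
        using z C(2) C(5)[of z] m'[of z] x1 by (cases "z = x1") (auto simp: x1_def)
      show "n z \<in> insert x C" using z C(5)[of z] less.prems by auto
      show "(x, z) \<in> ?R\<^sup>*"
        using z C(7)[of z] sub step by (auto intro: rtrancl_trans)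
      show "(m z = z) \<noteq> (n z = z) \<longleftrightarrow> z = x \<or> z = y"
      proof (cases "z = x")
        case True then show ?thesis using less.prems by auto
      next
        case False': False
        show ?thesis
        proof (cases "z = x1")
          case True then show ?thesis using x1 C False by auto
        next
          case False
          then show ?thesis using z False' C(6)[of z] m'[of z] by auto
        qed
      qed
    qed
  qed
qed

section \<open>Components of superposed matchings\<close>

definition adj :: "'a set \<Rightarrow> 'a set set \<Rightarrow> ('a \<times> 'a) set" where
  "adj V H = {(v,w). \<exists>e\<in>H. v \<in> e \<inter> V \<and> w \<in> e \<inter> V}"

definition graph_component :: "'a set \<Rightarrow> 'a set set \<Rightarrow> 'a \<Rightarrow> 'a set" where
  "graph_component V H x = {z. (x,z) \<in> (adj V H)\<^sup>*}"

lemma sym_adj: "sym ((adj V H)\<^sup>*)"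
  by (intro sym_rtrancl symI) (auto simp: adj_def)

lemma graph_component_eq: "z \<in> graph_component V H x \<Longrightarrow> graph_component V H z = graph_component V H x"
  unfolding graph_component_def using sym_adj[of V H] by (auto dest: symD intro: rtrancl_trans)

lemma graph_component_refl [simp]: "x \<in> graph_component V H x"
  by (simp add: graph_component_def)

lemma graph_component_subset: "x \<in> V \<Longrightarrow> graph_component V H x \<subseteq> V"
proof
  fix z assume "x \<in> V" "z \<in> graph_component V H x"
  then have "(x,z) \<in> (adj V H)\<^sup>*" "x \<in> V" by (auto simp: graph_component_def)
  then show "z \<in> V" by (induction rule: rtrancl_induct) (auto simp: adj_def)
qed

lemma graph_component_closed: "e \<in> H \<Longrightarrow> x \<in> V \<Longrightarrow> e \<inter> graph_component V H x \<noteq> {} \<Longrightarrow> e \<inter> V \<subseteq> graph_component V H x"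
proof
  fix w assume e: "e \<in> H" "x \<in> V" "e \<inter> graph_component V H x \<noteq> {}" and w: "w \<in> e \<inter> V"
  then obtain v where v: "v \<in> e" "v \<in> graph_component V H x" by blast
  then have "(v,w) \<in> adj V H" using graph_component_subset[OF e(2)] e w by (auto simp: adj_def)
  then show "w \<in> graph_component V H x" using v(2) unfolding graph_component_def by (auto intro: rtrancl.rtrancl_into_rtrancl)
qed

abbreviation matchings_missing :: "complex set \<Rightarrow> complex set set \<Rightarrow> complex set \<Rightarrow> complex set set set" where
  "matchings_missing V E X \<equiv> perfect_matchings (V - X) {e \<in> E. e \<inter> X = {}}"

text \<open>Turns a matching into an involution of \<open>V\<close> whose fixed points are exactly
  the missing vertices, as needed for \<open>involution_component\<close>.\<close>

lemma matching_mate: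
  assumes E: "\<And>e. e \<in> E \<Longrightarrow> \<exists>a b. a \<noteq> b \<and> e \<inter> V = {a,b}"
    and M: "M \<in> matchings_missing V E X" "X \<subseteq> V"
  obtains m where "\<And>v. v \<in> V \<Longrightarrow> m v \<in> V" "\<And>v. v \<in> V \<Longrightarrow> m (m v) = v"
    "\<And>v. v \<in> V \<Longrightarrow> m v = v \<longleftrightarrow> v \<in> X" "\<And>v e. v \<in> V \<Longrightarrow> e \<in> M \<Longrightarrow> v \<in> e \<Longrightarrow> e \<inter> V = {v, m v}"
    "\<And>v. v \<in> V - X \<Longrightarrow> \<exists>e\<in>M. e \<inter> V = {v, m v}"
proof -
  have ME: "e \<in> E" "e \<inter> X = {}" if "e \<in> M" for e
    using M(1) that unfolding perfect_matchings_def by blast+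
  have uniq: "\<exists>!e. e \<in> M \<and> v \<in> e" if "v \<in> V - X" for v
    using M(1) that unfolding perfect_matchings_def by blast
  define P where "P v w \<longleftrightarrow> (if v \<in> X then w = v else \<exists>e\<in>M. v \<noteq> w \<and> e \<inter> V = {v,w})" for v w
  have ex: "\<exists>w. P v w" if v: "v \<in> V" for v
  proof (cases "v \<in> X")
    case False
    then obtain e where e: "e \<in> M" "v \<in> e" using uniq v by blast
    obtain a b where "a \<noteq> b" "e \<inter> V = {a,b}" using E[OF ME(1)[OF e(1)]] by blast
    moreover have "v \<in> e \<inter> V" using v e by simp
    ultimately have "v \<noteq> (if v = a then b else a) \<and> e \<inter> V = {v, if v = a then b else a}" by auto
    then have "\<exists>w. v \<noteq> w \<and> e \<inter> V = {v,w}" by blast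
    then show ?thesis using False e unfolding P_def by auto
  qed (auto simp: P_def)
  define m where "m v = (SOME w. P v w)" for v
  have m: "P v (m v)" if "v \<in> V" for v using ex[OF that] unfolding m_def by (rule someI_ex)
  show ?thesis
  proof
    fix v assume v: "v \<in> V"
    show mV: "m v \<in> V" using m[OF v] v unfolding P_def by (auto split: if_splits)
    show "m v = v \<longleftrightarrow> v \<in> X" using m[OF v] unfolding P_def by (auto split: if_splits)
    have edge: "e \<inter> V = {v, m v}" if e: "e \<in> M" "v \<in> e" for e
    proof -
      have vX: "v \<notin> X" using ME e by blast
      then obtain e' where e': "e' \<in> M" "e' \<inter> V = {v, m v}" using m[OF v] by (auto simp: P_def)
      then have "e = e'" using uniq[of v] vX v e by blast
      then show ?thesis using e' by simp
    qed
    then show "\<And>e. e \<in> M \<Longrightarrow> v \<in> e \<Longrightarrow> e \<inter> V = {v, m v}" .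
    show "m (m v) = v"
    proof (cases "v \<in> X")
      case True
      then have "m v = v" using m[OF v] by (simp add: P_def)
      then show ?thesis by simp
    next
      case False
      then obtain e where e: "e \<in> M" "v \<noteq> m v" "e \<inter> V = {v, m v}"
        using m[OF v] by (auto simp: P_def)
      then have mX: "m v \<notin> X" using ME by blast
      then obtain e' where e': "e' \<in> M" "m v \<noteq> m (m v)" "e' \<inter> V = {m v, m (m v)}"
        using m[OF mV] by (auto simp: P_def)
      have "e = e'" using uniq[of "m v"] mX mV e e' by blast
      then show ?thesis using e e' by (metis doubleton_eq_iff)
    qed
  next
    fix v assume "v \<in> V - X"
    then show "\<exists>e\<in>M. e \<inter> V = {v, m v}" using m[of v] by (auto simp: P_def)
  qed
qed

lemma superposition_component:
  assumes V: "finite V" and E: "\<And>e. e \<in> E \<Longrightarrow> \<exists>a b. a \<noteq> b \<and> e \<inter> V = {a,b}"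
    and M: "M \<in> matchings_missing V E X" "X \<subseteq> V" and N: "N \<in> matchings_missing V E Y" "Y \<subseteq> V"
    and x: "x \<in> sym_diff X Y"
  obtains y where "y \<noteq> x" "graph_component V (M \<union> N) x \<inter> sym_diff X Y = {x,y}"
proof -
  \<comment> \<open>It is enough to start at a vertex missed by the second matching only; the other
    case follows by exchanging \<open>M\<close> and \<open>N\<close>.\<close>
  have *: thesis if M: "M \<in> matchings_missing V E X" "X \<subseteq> V" and N: "N \<in> matchings_missing V E Y" "Y \<subseteq> V"
    and x: "x \<in> Y - X" and th: "\<And>y. y \<noteq> x \<Longrightarrow> graph_component V (M \<union> N) x \<inter> sym_diff X Y = {x,y} \<Longrightarrow> thesis"
    for M N X Y
  proof -
    obtain m where m: "\<And>v. v \<in> V \<Longrightarrow> m v \<in> V" "\<And>v. v \<in> V \<Longrightarrow> m (m v) = v"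
      "\<And>v. v \<in> V \<Longrightarrow> m v = v \<longleftrightarrow> v \<in> X" "\<And>v e. v \<in> V \<Longrightarrow> e \<in> M \<Longrightarrow> v \<in> e \<Longrightarrow> e \<inter> V = {v, m v}"
      "\<And>v. v \<in> V - X \<Longrightarrow> \<exists>e\<in>M. e \<inter> V = {v, m v}"
      using matching_mate[OF E M] by blast
    obtain k where k: "\<And>v. v \<in> V \<Longrightarrow> k v \<in> V" "\<And>v. v \<in> V \<Longrightarrow> k (k v) = v"
      "\<And>v. v \<in> V \<Longrightarrow> k v = v \<longleftrightarrow> v \<in> Y" "\<And>v e. v \<in> V \<Longrightarrow> e \<in> N \<Longrightarrow> v \<in> e \<Longrightarrow> e \<inter> V = {v, k v}"
      "\<And>v. v \<in> V - Y \<Longrightarrow> \<exists>e\<in>N. e \<inter> V = {v, k v}"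
      using matching_mate[OF E N] by blast
    have xV: "x \<in> V" using x N by blast
    obtain C y where C: "C \<subseteq> V" "x \<in> C" "y \<in> C" "y \<noteq> x" "\<And>z. z \<in> C \<Longrightarrow> m z \<in> C \<and> k z \<in> C"
      "\<And>z. z \<in> C \<Longrightarrow> (m z = z) \<noteq> (k z = z) \<longleftrightarrow> z = x \<or> z = y"
      "\<And>z. z \<in> C \<Longrightarrow> (x, z) \<in> {(v,w). w = m v \<or> w = k v}\<^sup>*"
    proof -
      have kx: "k x = x" "m x \<noteq> x" using k(3) m(3) x xV by auto
      have "\<exists>C y. C \<subseteq> V \<and> x \<in> C \<and> y \<in> C \<and> y \<noteq> x \<and> (\<forall>z\<in>C. m z \<in> C \<and> k z \<in> C)
          \<and> (\<forall>z\<in>C. (m z = z) \<noteq> (k z = z) \<longleftrightarrow> z = x \<or> z = y)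
          \<and> (\<forall>z\<in>C. (x, z) \<in> {(v,w). w = m v \<or> w = k v}\<^sup>*)"
        by (rule involution_component) (fact V m k xV kx)+
      then obtain C y where C: "C \<subseteq> V \<and> x \<in> C \<and> y \<in> C \<and> y \<noteq> x \<and> (\<forall>z\<in>C. m z \<in> C \<and> k z \<in> C)
          \<and> (\<forall>z\<in>C. (m z = z) \<noteq> (k z = z) \<longleftrightarrow> z = x \<or> z = y)
          \<and> (\<forall>z\<in>C. (x, z) \<in> {(v,w). w = m v \<or> w = k v}\<^sup>*)" by (elim exE)
      show thesis by (rule that[of C y]) (use C in auto)
    qed
    have "graph_component V (M \<union> N) x = C"
    proof
      show "graph_component V (M \<union> N) x \<subseteq> C"
      proof
        fix z assume "z \<in> graph_component V (M \<union> N) x"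
        then have "(x,z) \<in> (adj V (M \<union> N))\<^sup>*" by (simp add: graph_component_def)
        then show "z \<in> C"
        proof (induction rule: rtrancl_induct)
          case (step v w)
          then obtain e where e: "e \<in> M \<union> N" "v \<in> e" "v \<in> V" "w \<in> e \<inter> V" by (auto simp: adj_def)
          then have "w \<in> {v, m v, k v}" using m(4) k(4) by blast
          then show ?case using C(5)[OF step.IH] step.IH by auto
        qed (use C in auto)
      qed
      show "C \<subseteq> graph_component V (M \<union> N) x"
      proof
        fix z assume "z \<in> C"
        then have "(x, z) \<in> {(v,w). w = m v \<or> w = k v}\<^sup>*" using C by blast
        then have "z \<in> V \<and> (x,z) \<in> (adj V (M \<union> N))\<^sup>*"
        proof (induction rule: rtrancl_induct)
          case (step v w)
          then have v: "v \<in> V" by blast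
          have "w = v \<or> (v,w) \<in> adj V (M \<union> N)"
          proof (cases "w = v")
            case False
            then have "\<exists>e\<in>M \<union> N. e \<inter> V = {v,w}"
              using step.hyps(2) m(3,5)[of v] k(3,5)[of v] v by auto
            then show ?thesis by (auto simp: adj_def)
          qed auto
          moreover have "w \<in> V" using step.hyps(2) v m k by auto
          ultimately show ?case using step.IH by (auto intro: rtrancl.rtrancl_into_rtrancl)
        qed (use xV in auto)
        then show "z \<in> graph_component V (M \<union> N) x" by (simp add: graph_component_def)
      qed
    qed
    moreover have "C \<inter> sym_diff X Y = {x,y}"
      using C(1-4) C(6) m(3) k(3) by blast
    ultimately show thesis using th C(4) by blast
  qed
  show thesis
  proof (cases "x \<in> Y - X")
    case True
    then show ?thesis using *[OF M N] that by blast
  next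
    case False
    then have "x \<in> X - Y" using x by blast
    then show ?thesis using *[OF N M] that by (simp add: Un_commute)
  qed
qed

section \<open>Exchanging two matchings along a component\<close>

definition switch :: "'a set \<Rightarrow> 'a set set \<Rightarrow> 'a set set \<Rightarrow> 'a set set" where
  "switch C M N = {e \<in> M. e \<inter> C = {}} \<union> {e \<in> N. e \<inter> C \<noteq> {}}"

lemma switch_Un [simp]: "switch C M N \<union> switch C N M = M \<union> N"
  by (auto simp: switch_def)

lemma switch_switch [simp]: "switch C (switch C M N) (switch C N M) = M"
  by (auto simp: switch_def)

text \<open>The two switched sets together contain every edge as often as \<open>M\<close> and
  \<open>N\<close> do; an edge lying in both stays in both.\<close>

lemma prod_switch:
  fixes w :: "'a set \<Rightarrow> complex"
  assumes "finite M" "finite N"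
  shows "prod w (switch C M N) * prod w (switch C N M) = prod w M * prod w N"
proof -
  have 1: "prod w (switch C M N) = prod w {e \<in> M. e \<inter> C = {}} * prod w {e \<in> N. e \<inter> C \<noteq> {}}"
    if "finite M" "finite N" for M N
    using that unfolding switch_def by (intro prod.union_disjoint) auto
  have 2: "prod w M = prod w {e \<in> M. e \<inter> C = {}} * prod w {e \<in> M. e \<inter> C \<noteq> {}}"
    if "finite M" for M
    using that by (subst prod.union_disjoint[symmetric]) (auto intro: arg_cong[where f = "prod w"])
  show ?thesis
    unfolding 1[OF assms] 1[OF assms(2,1)] 2[OF assms(1)] 2[OF assms(2)] by (simp only: ac_simps)
qed

text \<open>No edge of \<open>M \<union> N\<close> leaves the component \<open>C\<close>, so a
  vertex outside \<open>C\<close> keeps its edge in \<open>M\<close> and a vertex inside gets its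
  edge in \<open>N\<close>. The missing vertices are exchanged in the same way.\<close>

lemma switch_matching:
  assumes M: "M \<in> matchings_missing V E X" "X \<subseteq> V" and N: "N \<in> matchings_missing V E Y" "Y \<subseteq> V"
    and x: "x \<in> V" and C: "C = graph_component V (M \<union> N) x"
  shows "switch C M N \<in> matchings_missing V E ((X - C) \<union> (Y \<inter> C))"
proof -
  let ?Z = "(X - C) \<union> (Y \<inter> C)"
  have M': "M \<subseteq> E" "\<And>e. e \<in> M \<Longrightarrow> e \<inter> X = {}" "\<And>v. v \<in> V - X \<Longrightarrow> \<exists>!e. e \<in> M \<and> v \<in> e"
    using M(1) unfolding perfect_matchings_def by blast+
  have N': "N \<subseteq> E" "\<And>e. e \<in> N \<Longrightarrow> e \<inter> Y = {}" "\<And>v. v \<in> V - Y \<Longrightarrow> \<exists>!e. e \<in> N \<and> v \<in> e"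
    using N(1) unfolding perfect_matchings_def by blast+
  have cl: "e \<inter> V \<subseteq> C" if "e \<in> M \<union> N" "e \<inter> C \<noteq> {}" for e
    using graph_component_closed[OF that(1) x] that(2) C by auto
  have CV: "C \<subseteq> V" using graph_component_subset[OF x] C by auto
  have "switch C M N \<subseteq> {e \<in> E. e \<inter> ?Z = {}}"
  proof
    fix e assume "e \<in> switch C M N"
    then consider "e \<in> M" "e \<inter> C = {}" | "e \<in> N" "e \<inter> C \<noteq> {}" by (auto simp: switch_def)
    then show "e \<in> {e \<in> E. e \<inter> ?Z = {}}"
    proof cases
      case 1 then show ?thesis using M' by auto
    next
      case 2
      then have "e \<inter> V \<subseteq> C" using cl by blast
      then show ?thesis using N'(1) N'(2)[OF 2(1)] 2(1) M(2) by blast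
    qed
  qed
  moreover have "\<exists>!e. e \<in> switch C M N \<and> v \<in> e" if v: "v \<in> V - ?Z" for v
  proof (cases "v \<in> C")
    case True
    then have "v \<in> V - Y" using v by auto
    then have "\<exists>!e. e \<in> N \<and> v \<in> e" by (rule N')
    moreover have "e \<in> switch C M N \<and> v \<in> e \<longleftrightarrow> e \<in> N \<and> v \<in> e" for e
      using True by (auto simp: switch_def)
    ultimately show ?thesis by auto
  next
    case False
    then have "v \<in> V - X" using v by auto
    then have "\<exists>!e. e \<in> M \<and> v \<in> e" by (rule M')
    moreover have "e \<in> switch C M N \<and> v \<in> e \<longleftrightarrow> e \<in> M \<and> v \<in> e" for e
      using False v cl[of e] by (auto simp: switch_def)
    ultimately show ?thesis by auto
  qed
  ultimately show ?thesis unfolding perfect_matchings_def by auto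
qed

text \<open>This is the form in which planarity enters the superposition argument. It ranges over
  all subgraphs \<open>H\<close> because the superposition \<open>M \<union> N\<close> changes from
  term to term.\<close>

definition noncrossing :: "'a set \<Rightarrow> 'a set set \<Rightarrow> nat \<Rightarrow> (nat \<Rightarrow> 'a) \<Rightarrow> bool" where
  "noncrossing V E n u \<longleftrightarrow> (\<forall>H i j k l. H \<subseteq> E \<longrightarrow> 1 \<le> i \<longrightarrow> i < j \<longrightarrow> j < k \<longrightarrow> k < l \<longrightarrow> l \<le> n \<longrightarrow>
     u k \<in> graph_component V H (u i) \<longrightarrow> u l \<in> graph_component V H (u j) \<longrightarrow> u j \<in> graph_component V H (u i))"

text \<open>Superpose a matching contributing to the first factor with one contributing to the second and
  swap them along the component of the \<open>i\<close>-th node. This component is a path ending at some other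
  node \<open>t i\<close>, and as the paths do not cross, \<open>i\<close> and \<open>t i\<close> enter the sum with opposite signs.\<close>

lemma noncrossing_matchgate_identities:
  assumes V: "finite V" and finE: "finite E" and E: "\<And>e. e \<in> E \<Longrightarrow> \<exists>a b. a \<noteq> b \<and> e \<inter> V = {a,b}"
    and u: "inj_on u {1..n}" "u ` {1..n} \<subseteq> V" and nc: "noncrossing V E n u"
  shows "matchgate_identities id {1..n} (\<lambda>S. PM (V - u ` S) {e \<in> E. e \<inter> u ` S = {}} w)"
  unfolding matchgate_identities_def
proof (intro allI impI)
  fix A B assume AB: "A \<subseteq> {1..n}" "B \<subseteq> {1..n}"
  define D where "D = sym_diff A B"
  have D: "finite D" "D \<subseteq> {1..n}" using AB by (auto simp: D_def intro: finite_subset)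
  define sg where "sg i = ((-1) ^ card {k \<in> D. id k < id i} :: complex)" for i :: nat
  define MM where "MM S = matchings_missing V E (u ` S)" for S
  have finMM: "finite (MM S)" for S
    unfolding MM_def perfect_matchings_def
    by (rule finite_subset[of _ "Pow E"]) (use finE in auto)
  have finM: "finite M" if "M \<in> MM S" for M S
    using that finE finite_subset unfolding MM_def perfect_matchings_def by fastforce
  define \<Omega> where "\<Omega> = (SIGMA i : D. MM (sym_diff A {i}) \<times> MM (sym_diff B {i}))"
  define h where "h = (\<lambda>(i,M,N). sg i * (prod w M * prod w N))"
  \<comment> \<open>The label at the other end of the path that starts at node \<open>i\<close>; the
    choice is determined once the component meets exactly two nodes with labels in
    \<open>D\<close>.\<close>
  define t where "t H i = (SOME k. k \<noteq> i \<and> {j \<in> D. u j \<in> graph_component V H (u i)} = {i,k})" for H i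
  define \<phi> where "\<phi> = (\<lambda>(i,M,N). (t (M \<union> N) i, switch (graph_component V (M \<union> N) (u i)) M N,
      switch (graph_component V (M \<union> N) (u i)) N M))"
  have uV: "u ` S \<subseteq> V" if "S \<subseteq> {1..n}" for S using u that by auto
  have sub: "sym_diff A {i} \<subseteq> {1..n}" "sym_diff B {i} \<subseteq> {1..n}" if "i \<in> D" for i
    using AB D that by auto
  \<comment> \<open>Toggling \<open>i\<close> in both \<open>A\<close> and \<open>B\<close> does not
    alter their symmetric difference, so for every \<open>i\<close> the nodes missed by exactly one
    of the two matchings are those with labels in \<open>D\<close>.\<close>
  have img: "sym_diff (u ` sym_diff A {i}) (u ` sym_diff B {i}) = u ` D" if "i \<in> D" for i
  proof -
    have "u ` P - u ` Q = u ` (P - Q)" if "P \<subseteq> {1..n}" "Q \<subseteq> {1..n}" for P Q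
      using that by (intro inj_on_image_set_diff[OF u(1), symmetric]) auto
    then have "sym_diff (u ` sym_diff A {i}) (u ` sym_diff B {i}) = u ` sym_diff (sym_diff A {i}) (sym_diff B {i})"
      using sub[OF that] by (simp only: image_Un[of u "sym_diff A {i} - sym_diff B {i}"])
    also have "sym_diff (sym_diff A {i}) (sym_diff B {i}) = D" by (auto simp: D_def)
    finally show ?thesis .
  qed
  have t_props: "t (M \<union> N) j \<noteq> j" "{k \<in> D. u k \<in> graph_component V (M \<union> N) (u j)} = {j, t (M \<union> N) j}"
    if \<Omega>: "(i,M,N) \<in> \<Omega>" and j: "j \<in> D" for i j M N
  proof -
    have i: "i \<in> D" and MN: "M \<in> MM (sym_diff A {i})" "N \<in> MM (sym_diff B {i})"
      using \<Omega> by (auto simp: \<Omega>_def)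
    have "u j \<in> sym_diff (u ` sym_diff A {i}) (u ` sym_diff B {i})"
      using j by (simp only: img[OF i]) blast
    from superposition_component[OF V E MN(1)[unfolded MM_def] uV[OF sub(1)[OF i]]
        MN(2)[unfolded MM_def] uV[OF sub(2)[OF i]] this]
    obtain y where y: "y \<noteq> u j" "graph_component V (M \<union> N) (u j) \<inter> u ` D = {u j, y}"
      by (metis img[OF i])
    then obtain k where k: "k \<in> D" "y = u k" by blast
    have "{l \<in> D. u l \<in> graph_component V (M \<union> N) (u j)} = {j,k}"
    proof -
      have "l = j \<or> l = k" if "l \<in> D" "u l \<in> graph_component V (M \<union> N) (u j)" for l
      proof -
        have "u l = u j \<or> u l = u k" using y k that by blast
        then show ?thesis using u(1) D that j k by (meson inj_onD subset_eq)
      qed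
      moreover have "u k \<in> graph_component V (M \<union> N) (u j)" using y k by blast
      ultimately show ?thesis using j k by auto
    qed
    then have "\<exists>k. k \<noteq> j \<and> {l \<in> D. u l \<in> graph_component V (M \<union> N) (u j)} = {j,k}"
      using y k by (intro exI[of _ k]) auto
    then have "t (M \<union> N) j \<noteq> j \<and> {l \<in> D. u l \<in> graph_component V (M \<union> N) (u j)} = {j, t (M \<union> N) j}"
      unfolding t_def by (rule someI_ex)
    then show "t (M \<union> N) j \<noteq> j" "{k \<in> D. u k \<in> graph_component V (M \<union> N) (u j)} = {j, t (M \<union> N) j}" by auto
  qed
  have t_comp: "t (M \<union> N) j \<in> D" "graph_component V (M \<union> N) (u (t (M \<union> N) j)) = graph_component V (M \<union> N) (u j)"
     "t (M \<union> N) (t (M \<union> N) j) = j"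
    if \<Omega>: "(i,M,N) \<in> \<Omega>" and j: "j \<in> D" for i j M N
  proof -
    let ?k = "t (M \<union> N) j"
    have "?k \<in> {k \<in> D. u k \<in> graph_component V (M \<union> N) (u j)}" using t_props(2)[OF that] by auto
    then show k: "?k \<in> D" "graph_component V (M \<union> N) (u ?k) = graph_component V (M \<union> N) (u j)"
      using graph_component_eq[of "u ?k" V "M \<union> N" "u j"] by auto
    have "{?k, t (M \<union> N) ?k} = {j, ?k}"
      using t_props(2)[OF that] t_props(2)[OF \<Omega> k(1)] k(2) by simp
    then show "t (M \<union> N) ?k = j" using t_props(1)[OF that] by (metis doubleton_eq_iff)
  qed
  have sg_t: "sg (t (M \<union> N) i) = - sg i" if \<Omega>: "(i,M,N) \<in> \<Omega>" for i M N
    unfolding sg_def id_apply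
  proof (rule noncrossing_pairing_sign)
    show "finite D" by (fact D)
    show "i \<in> D" using \<Omega> by (simp add: \<Omega>_def)
    show "t (M \<union> N) x \<in> D" "t (M \<union> N) (t (M \<union> N) x) = x" if "x \<in> D" for x
      using t_comp[OF \<Omega> that] by auto
    show "t (M \<union> N) x \<noteq> x" if "x \<in> D" for x
      using t_props[OF \<Omega> that] by auto
    fix j k assume *: "j \<in> D" "k \<in> D" "j < k" "k < t (M \<union> N) j" "t (M \<union> N) j < t (M \<union> N) k"
    have H: "M \<union> N \<subseteq> E" using \<Omega> by (auto simp: \<Omega>_def MM_def perfect_matchings_def)
    have "1 \<le> j" "t (M \<union> N) k \<le> n" using * t_comp[OF \<Omega>] D by force+
    moreover have "u (t (M \<union> N) j) \<in> graph_component V (M \<union> N) (u j)" "u (t (M \<union> N) k) \<in> graph_component V (M \<union> N) (u k)"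
      using t_comp(2)[OF \<Omega>] * graph_component_refl by metis+
    ultimately have "u k \<in> graph_component V (M \<union> N) (u j)"
      using nc[unfolded noncrossing_def, rule_format, OF H] * by blast
    then have "k \<in> {j, t (M \<union> N) j}" using t_props(2)[OF \<Omega> *(1)] * by blast
    then show False using * by auto
  qed
  have \<phi>: "\<phi> x \<in> \<Omega>" "\<phi> (\<phi> x) = x" "h (\<phi> x) = - h x" if "x \<in> \<Omega>" for x
  proof -
    obtain i M N where x: "x = (i,M,N)" by (cases x)
    have \<Omega>: "(i,M,N) \<in> \<Omega>" using that x by simp
    then have i: "i \<in> D" and MN: "M \<in> MM (sym_diff A {i})" "N \<in> MM (sym_diff B {i})"
      by (auto simp: \<Omega>_def)
    define C where "C = graph_component V (M \<union> N) (u i)"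
    define k where "k = t (M \<union> N) i"
    have k: "k \<in> D" "k \<noteq> i" "t (M \<union> N) k = i" "graph_component V (M \<union> N) (u k) = C" "sg k = - sg i"
      using t_comp[OF \<Omega> i] t_props[OF \<Omega> i] sg_t[OF \<Omega>] by (auto simp: k_def C_def)
    have Cik: "{j \<in> D. u j \<in> C} = {i,k}" using t_props(2)[OF \<Omega> i] by (simp add: C_def k_def)
    have ui: "u i \<in> V" using i D u by auto
    \<comment> \<open>\<open>A\<close> and \<open>B\<close> agree outside \<open>D\<close>, and
      within \<open>D\<close> the component contains only \<open>i\<close> and \<open>k\<close>.
      Exchanging the missing nodes in it therefore amounts to toggling \<open>k\<close> in place of
      \<open>i\<close>.\<close>
    have new: "u ` sym_diff A {i} - C \<union> u ` sym_diff B {i} \<inter> C = u ` sym_diff A {k}"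
      if AB: "A \<subseteq> {1..n}" "B \<subseteq> {1..n}" and DD: "D = sym_diff A B" for A B
    proof -
      have "j \<in> sym_diff A {k} \<longleftrightarrow> (j \<in> sym_diff A {i} \<and> u j \<notin> C) \<or> (j \<in> sym_diff B {i} \<and> u j \<in> C)"
        for j
        using Cik k(1,2) i unfolding DD by blast
      then show ?thesis by blast
    qed
    have e: "\<phi> x = (k, switch C M N, switch C N M)" by (simp add: \<phi>_def x k_def C_def)
    have "switch C M N \<in> MM (sym_diff A {k})"
      using switch_matching[OF MN(1)[unfolded MM_def] uV[OF sub(1)[OF i]]
        MN(2)[unfolded MM_def] uV[OF sub(2)[OF i]] ui C_def] new[OF AB D_def]
      by (simp add: MM_def)
    moreover have "switch C N M \<in> MM (sym_diff B {k})"
      using switch_matching[OF MN(2)[unfolded MM_def] uV[OF sub(2)[OF i]]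
        MN(1)[unfolded MM_def] uV[OF sub(1)[OF i]] ui C_def[unfolded Un_commute[of M]]] new[OF AB(2,1)]
      by (simp add: MM_def D_def Un_commute)
    ultimately show "\<phi> x \<in> \<Omega>" using k by (simp add: \<Omega>_def e)
    show "\<phi> (\<phi> x) = x" unfolding e by (simp add: \<phi>_def k x)
    show "h (\<phi> x) = - h x" unfolding e
      using prod_switch[OF finM[OF MN(1)] finM[OF MN(2)]] k by (simp add: h_def x)
  qed
  have double_sum: "c * sum f P * sum g Q = (\<Sum>x\<in>P. \<Sum>y\<in>Q. c * (f x * g y))"
    for c :: complex and f g :: "complex set set \<Rightarrow> complex" and P Q
    unfolding mult.assoc[of c] sum_product by (simp only: sum_distrib_left)
  have "(\<Sum>i\<in>D. sg i * PM (V - u ` sym_diff A {i}) {e \<in> E. e \<inter> u ` sym_diff A {i} = {}} w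
      * PM (V - u ` sym_diff B {i}) {e \<in> E. e \<inter> u ` sym_diff B {i} = {}} w) = sum h \<Omega>"
    unfolding \<Omega>_def h_def PM_def MM_def[symmetric]
    using D finMM
    by (simp add: sum.Sigma[symmetric] sum.cartesian_product[symmetric] double_sum)
  \<comment> \<open>\<open>\<phi>\<close> is an involution of the index set that negates every
    summand.\<close>
  moreover have "sum h \<Omega> = (\<Sum>x\<in>\<Omega>. - h x)"
    by (rule sum.reindex_bij_witness[of _ \<phi> \<phi>]) (use \<phi> in auto)
  then have "sum h \<Omega> = 0" by (simp add: sum_negf)
  ultimately show "(\<Sum>i\<in>sym_diff A B. (-1) ^ card {k \<in> sym_diff A B. id k < id i}
      * PM (V - u ` sym_diff A {i}) {e \<in> E. e \<inter> u ` sym_diff A {i} = {}} w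
      * PM (V - u ` sym_diff B {i}) {e \<in> E. e \<inter> u ` sym_diff B {i} = {}} w) = 0"
    by (simp only: sg_def D_def)
qed

section \<open>Disjoint paths in a disc do not cross\<close>

text \<open>The arc \<open>p\<close> divides the inside of \<open>h\<close> into two regions. The
  arc \<open>q\<close> without its ends meets neither \<open>p\<close> nor \<open>h\<close>, so it
  stays in one region, whose boundary contains only one of the two end points of
  \<open>q\<close>.\<close>

lemma chord_crossing_aux:
  fixes h p q :: "real \<Rightarrow> complex"
  assumes h: "simple_path h" "pathfinish h = pathstart h"
    and s: "0 < sb" "sb < sc" "sc < sd" "sd < 1"
    and p: "arc p" "pathstart p = h 0" "pathfinish p = h sc"
      "path_image p \<subseteq> path_image h \<union> inside (path_image h)" "path_image p \<inter> path_image h = {h 0, h sc}"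
    and q: "arc q" "pathstart q = h sb" "pathfinish q = h sd"
      "path_image q \<subseteq> path_image h \<union> inside (path_image h)" "path_image q \<inter> path_image h = {h sb, h sd}"
    and disj: "path_image p \<inter> path_image q = {}"
  shows False
proof -
  have inj: "x = y \<or> x = 0 \<and> y = 1 \<or> x = 1 \<and> y = 0" if "x \<in> {0..1}" "y \<in> {0..1}" "h x = h y" for x y
    using h(1) that unfolding simple_path_def loop_free_def by blast
  have h01: "h 1 = h 0" using h(2) by (simp add: pathfinish_def pathstart_def)
  define c1 where "c1 = subpath 0 sc h"
  \<comment> \<open>Run backwards from \<open>h 1 = h 0\<close>, so that \<open>c1\<close>,
    \<open>c2\<close> and \<open>p\<close> all lead from \<open>h 0\<close> to
    \<open>h sc\<close>.\<close>
  define c2 where "c2 = subpath 1 sc h"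
  have c1i: "path_image c1 = h ` {0..sc}" and c2i: "path_image c2 = h ` {sc..1}"
    using s by (auto simp: c1_def c2_def path_image_subpath)
  have un: "path_image c1 \<union> path_image c2 = path_image h"
  proof -
    have "{0..1} = {0..sc} \<union> {sc..1}" using s by auto
    then show ?thesis by (simp only: c1i c2i path_image_def[of h] image_Un)
  qed
  have int: "path_image c1 \<inter> path_image c2 = {h 0, h sc}"
  proof
    show "path_image c1 \<inter> path_image c2 \<subseteq> {h 0, h sc}"
    proof
      fix z assume "z \<in> path_image c1 \<inter> path_image c2"
      then obtain x y where xy: "x \<in> {0..sc}" "y \<in> {sc..1}" "z = h x" "h x = h y"
        unfolding c1i c2i by auto
      then show "z \<in> {h 0, h sc}" using inj[of x y] s by auto
    qed
    show "{h 0, h sc} \<subseteq> path_image c1 \<inter> path_image c2"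
      unfolding c1i c2i using s h01 by (auto intro!: image_eqI[of "h 0" h 1])
  qed
  have ne: "h 0 \<noteq> h sc" using inj[of 0 sc] s by auto
  have c12: "simple_path c1" "simple_path c2" "pathstart c1 = h 0" "pathfinish c1 = h sc"
    "pathstart c2 = h 0" "pathfinish c2 = h sc"
    using s h h01 by (auto simp: c1_def c2_def intro!: simple_path_subpath)
  have p0: "path_image p \<inter> inside (path_image c1 \<union> path_image c2) \<noteq> {}"
  proof -
    have "p (1/2) \<noteq> p 0" "p (1/2) \<noteq> p 1"
      using p(1) unfolding arc_def inj_on_def by force+
    moreover have "p (1/2) \<in> path_image p" unfolding path_image_def by force
    ultimately have "p (1/2) \<in> inside (path_image h)"
      using p(2-5) by (auto simp: pathstart_def pathfinish_def)
    then show ?thesis using \<open>p (1/2) \<in> path_image p\<close> un by auto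
  qed
  define I1 where "I1 = inside (path_image c1 \<union> path_image p)"
  define I2 where "I2 = inside (path_image c2 \<union> path_image p)"
  have sub: "{h 0, h sc} \<subseteq> path_image p"
    using p(2,3) pathstart_in_path_image[of p] pathfinish_in_path_image[of p] by simp
  have "path_image c1 \<inter> path_image p = {h 0, h sc}" "path_image c2 \<inter> path_image p = {h 0, h sc}"
    using p(5) un int sub by blast+
  then obtain I: "I1 \<inter> I2 = {}" "I1 \<union> I2 \<union> (path_image p - {h 0, h sc}) = inside (path_image h)"
    using split_inside_simple_closed_curve[OF c12(1,3,4) c12(2,5,6) arc_imp_simple_path[OF p(1)] p(2,3) ne int _ _ p0]
    unfolding I1_def I2_def un by blast
  have cl: "closed (path_image c1 \<union> path_image p)" "closed (path_image c2 \<union> path_image p)"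
    using closed_path_image[OF simple_path_imp_path[OF c12(1)]] closed_path_image[OF simple_path_imp_path[OF c12(2)]]
      closed_path_image[OF arc_imp_path[OF p(1)]] by (auto intro: closed_Un)
  define Q where "Q = q ` {0<..<1}"
  have qc: "continuous_on {0..1} q" using q(1) by (simp add: arc_def path_def)
  have "connected Q" unfolding Q_def
    by (intro connected_continuous_image continuous_on_subset[OF qc]) auto
  have Qh: "Q \<inter> path_image h = {}"
  proof -
    have "q x \<noteq> q 0" "q x \<noteq> q 1" if "x \<in> {0<..<1}" for x
      using q(1) that unfolding arc_def inj_on_def by force+
    moreover have "Q \<subseteq> path_image q" unfolding Q_def path_image_def by auto
    moreover have "path_image q \<inter> path_image h = {q 0, q 1}"
      using q(2,3,5) by (simp add: pathstart_def pathfinish_def)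
    ultimately have "q x \<notin> path_image h" if "x \<in> {0<..<1}" for x
      using that unfolding Q_def by (metis Int_iff imageI insertE singletonD subset_eq)
    then show ?thesis unfolding Q_def by auto
  qed
  have Qq: "Q \<subseteq> path_image q" unfolding Q_def path_image_def by auto
  have QI: "Q \<subseteq> I1 \<union> I2" using Qh Qq q(4) disj I(2) by blast
  have "open I1" "open I2" unfolding I1_def I2_def using cl by (auto intro: open_inside)
  then have "I1 \<inter> Q = {} \<or> I2 \<inter> Q = {}"
    using connectedD[OF \<open>connected Q\<close>, of I1 I2] I(1) QI by blast
  then consider "Q \<subseteq> I2" | "Q \<subseteq> I1" using QI by blast
  moreover have ends: "q 0 \<in> closure Q" "q 1 \<in> closure Q"
  proof -
    have "q ` closure {0<..<1} \<subseteq> closure Q"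
      unfolding Q_def by (rule image_closure_subset) (use qc closure_subset[of "q ` {0<..<1}"] in auto)
    then show "q 0 \<in> closure Q" "q 1 \<in> closure Q" by auto
  qed
  have clI: "closure I1 \<subseteq> I1 \<union> path_image c1 \<union> path_image p" "closure I2 \<subseteq> I2 \<union> path_image c2 \<union> path_image p"
    unfolding closure_Un_frontier I1_def I2_def
    using frontier_inside_subset[OF cl(1)] frontier_inside_subset[OF cl(2)] by blast+
  have q01: "q 0 = h sb" "q 1 = h sd" "q 0 \<in> path_image q" "q 1 \<in> path_image q"
    using q(2,3) pathstart_in_path_image[of q] pathfinish_in_path_image[of q]
    by (simp_all add: pathstart_def pathfinish_def)
  have notI: "q 0 \<notin> I1 \<union> I2" "q 1 \<notin> I1 \<union> I2"
  proof -
    have "h sb \<in> path_image h" "h sd \<in> path_image h" using s by (auto simp: path_image_def)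
    then have "q 0 \<notin> inside (path_image h)" "q 1 \<notin> inside (path_image h)"
      using inside_no_overlap[of "path_image h"] unfolding q01 by blast+
    then show "q 0 \<notin> I1 \<union> I2" "q 1 \<notin> I1 \<union> I2"
      unfolding I(2)[symmetric] by simp_all
  qed
  ultimately show False
  proof cases
    case 1
    then have "q 0 \<in> I2 \<union> path_image c2 \<union> path_image p" using ends(1) clI(2) closure_mono[of Q I2] by blast
    then have "h sb \<in> path_image c2" using notI q01 disj by auto
    then obtain y where "y \<in> {sc..1}" "h sb = h y" unfolding c2i by auto
    then show False using inj[of sb y] s by auto
  next
    case 2
    then have "q 1 \<in> I1 \<union> path_image c1 \<union> path_image p" using ends(2) clI(1) closure_mono[of Q I1] by blast
    then have "h sd \<in> path_image c1" using notI q01 disj by auto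
    then obtain y where "y \<in> {0..sc}" "h sd = h y" unfolding c1i by auto
    then show False using inj[of sd y] s by auto
  qed
qed

text \<open>Shifting the parameter makes the first end point of \<open>p\<close> the base point of
  the closed curve.\<close>

lemma chord_crossing:
  fixes g p q :: "real \<Rightarrow> complex"
  assumes g: "simple_path g" "pathfinish g = pathstart g"
    and t: "0 \<le> ta" "ta < tb" "tb < tc" "tc < td" "td < 1"
    and p: "arc p" "pathstart p = g ta" "pathfinish p = g tc"
      "path_image p \<subseteq> path_image g \<union> inside (path_image g)" "path_image p \<inter> path_image g = {g ta, g tc}"
    and q: "arc q" "pathstart q = g tb" "pathfinish q = g td"
      "path_image q \<subseteq> path_image g \<union> inside (path_image g)" "path_image q \<inter> path_image g = {g tb, g td}"
    and disj: "path_image p \<inter> path_image q = {}"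
  shows False
proof -
  define h where "h = shiftpath ta g"
  have im: "path_image h = path_image g"
    unfolding h_def using g t by (intro path_image_shiftpath) auto
  have h: "simple_path h" "pathfinish h = pathstart h"
    unfolding h_def using g t by (auto intro!: simple_path_shiftpath closed_shiftpath)
  have e: "h 0 = g ta" "h (tb - ta) = g tb" "h (tc - ta) = g tc" "h (td - ta) = g td"
    using t by (auto simp: h_def shiftpath_def)
  show False
    by (rule chord_crossing_aux[OF h, of "tb - ta" "tc - ta" "td - ta" p q])
      (use t p q disj e im in simp_all)
qed

text \<open>A walk that leaves an index set \<open>I\<close> contains a piece from a node in \<open>I\<close> to a node outside of
  \<open>I\<close> that meets no other node: restart at every node in \<open>I\<close>, stop at the first one outside.\<close>

lemma crossing_segment:
  fixes V :: "complex set"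
  assumes G: "plane_graph V E" and H: "H \<subseteq> E" and u: "inj_on u {1..n}" "u ` {1..n} \<subseteq> V"
    and I: "I \<subseteq> {1..n}" "i \<in> I" "k \<in> {1..n} - I" and C: "C = graph_component V H (u i)" "u k \<in> C"
  obtains i' k' K where "i' \<in> I" "k' \<in> {1..n} - I" "u i' \<in> C" "u k' \<in> C" "path_connected K"
    "u i' \<in> K" "u k' \<in> K" "K \<inter> u ` {1..n} = {u i', u k'}" "K \<subseteq> C \<union> \<Union>{e \<in> H. e \<inter> V \<subseteq> C}"
proof -
  let ?R = "C \<union> \<Union>{e \<in> H. e \<inter> V \<subseteq> C}"
  have uiV: "u i \<in> V" using u I by auto
  \<comment> \<open>Invariant of the walk: either a piece that started at a node in \<open>I\<close>
    is still open at the current vertex, or a complete piece has already been found.\<close>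
  define A where "A v \<longleftrightarrow> (\<exists>i'\<in>I. \<exists>K. u i' \<in> C \<and> path_connected K \<and> u i' \<in> K \<and> v \<in> K \<and>
     K \<inter> u ` {1..n} = {u i'} \<and> K \<subseteq> ?R)" for v
  define B where "B \<longleftrightarrow> (\<exists>i'\<in>I. \<exists>k'\<in>{1..n} - I. \<exists>K. u i' \<in> C \<and> u k' \<in> C \<and> path_connected K \<and> u i' \<in> K \<and>
     u k' \<in> K \<and> K \<inter> u ` {1..n} = {u i', u k'} \<and> K \<subseteq> ?R)"
  have start: "A (u m)" if "m \<in> I" "u m \<in> C" for m
    unfolding A_def by (rule bexI[OF _ that(1)], rule exI[of _ "{u m}"]) (use that I in auto)
  have "(u i, u k) \<in> (adj V H)\<^sup>*" using C by (simp add: graph_component_def)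
  then have "A (u k) \<or> B"
  proof (induction rule: rtrancl_induct)
    case base
    then show ?case using start[OF I(2)] C by simp
  next
    case (step v w)
    show ?case
    proof (cases "B \<or> v = w")
      case True
      then show ?thesis using step.IH by auto
    next
      case False
      have wC: "w \<in> C" "v \<in> C"
        using step.hyps C unfolding graph_component_def by (auto intro: rtrancl.rtrancl_into_rtrancl)
      obtain e where e: "e \<in> H" "v \<in> e \<inter> V" "w \<in> e \<inter> V" using step.hyps(2) by (auto simp: adj_def)
      then have "e \<in> E" using H by blast
      then obtain g where g: "arc g" "path_image g = e" "e \<inter> V = {pathstart g, pathfinish g}"
        using G unfolding plane_graph_def by meson
      have eV: "e \<inter> V = {v,w}" using g(3) e False by auto
      have pe: "path_connected e" using g path_connected_path_image arc_imp_path by metis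
      obtain i' K where K: "i' \<in> I" "u i' \<in> C" "path_connected K" "u i' \<in> K" "v \<in> K"
        "K \<inter> u ` {1..n} = {u i'}" "K \<subseteq> ?R" using step.IH False unfolding A_def by blast
      have K': "path_connected (K \<union> e)" using K pe e by (intro path_connected_Un) auto
      have eR: "e \<subseteq> ?R" using eV wC e by auto
      have ext: "(K \<union> e) \<inter> u ` {1..n} = {u i'} \<union> ({w} \<inter> u ` {1..n})"
      proof -
        have "e \<inter> u ` {1..n} = (e \<inter> V) \<inter> u ` {1..n}" using u(2) by blast
        moreover have "v \<notin> u ` {1..n} \<or> v = u i'" using K(5,6) by blast
        ultimately show ?thesis unfolding Int_Un_distrib2 K(6) eV by auto
      qed
      show ?thesis
      proof (cases "w \<in> u ` {1..n}")
        case False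
        then have "A w" unfolding A_def using K K' eR ext e
          by (intro bexI[OF _ K(1)] exI[of _ "K \<union> e"]) auto
        then show ?thesis ..
      next
        case True
        then obtain m where m: "m \<in> {1..n}" "w = u m" by blast
        show ?thesis
        proof (cases "m \<in> I")
          case True
          then show ?thesis using start m wC by auto
        next
          case False
          then have "m \<in> {1..n} - I" using m by auto
          then have B unfolding B_def using K K' eR ext e m wC
            by (intro bexI[OF _ K(1)] bexI[of _ m] exI[of _ "K \<union> e"]) auto
          then show ?thesis ..
        qed
      qed
    qed
  qed
  moreover have "\<not> A (u k)"
  proof
    assume "A (u k)"
    then obtain i' K where K: "i' \<in> I" "u k \<in> K" "K \<inter> u ` {1..n} = {u i'}"
      unfolding A_def by blast
    then have "u k = u i'" using I(3) by blast
    then have "k = i'" using u(1) I K by (meson DiffD1 inj_onD subset_eq)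
    then show False using I K by blast
  qed
  ultimately have B by blast
  then show thesis unfolding B_def using that by blast
qed

text \<open>The enclosing curve lies in the outer face except at the nodes. So an arc in
  \<open>K\<close> from \<open>u a\<close> to \<open>u c\<close> meets it in these two points only
  and is a chord; likewise for \<open>L\<close>.\<close>

lemma clockwise_no_crossing:
  assumes G: "clockwise_on_outer_face V E n u" and u: "inj_on u {1..n}"
    and abcd: "1 \<le> a" "a < b" "b < c" "c < d" "d \<le> n"
    and K: "path_connected K" "u a \<in> K" "u c \<in> K" "K \<inter> u ` {1..n} = {u a, u c}" "K \<subseteq> V \<union> \<Union>E"
    and L: "path_connected L" "u b \<in> L" "u d \<in> L" "L \<inter> u ` {1..n} = {u b, u d}" "L \<subseteq> V \<union> \<Union>E"
    and "K \<inter> L = {}"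
  shows False
proof -
  from G[unfolded clockwise_on_outer_face_def] obtain g t where gt:
    "simple_path g \<and> pathfinish g = pathstart g \<and>
        (\<forall>z\<in>inside (path_image g). winding_number g z = -1) \<and>
        path_image g \<subseteq> outer_face V E \<union> u ` {1..n} \<and>
        V \<union> \<Union>E \<subseteq> path_image g \<union> inside (path_image g) \<and>
        strict_mono_on {1..n} t \<and> t ` {1..n} \<subseteq> {0..<1} \<and> (\<forall>i\<in>{1..n}. g (t i) = u i)"
    by (elim exE)
  then have g: "simple_path g" "pathfinish g = pathstart g"
    "path_image g \<subseteq> outer_face V E \<union> u ` {1..n}" "V \<union> \<Union>E \<subseteq> path_image g \<union> inside (path_image g)"
    and t: "strict_mono_on {1..n} t" "t ` {1..n} \<subseteq> {0..<1}" "\<And>i. i \<in> {1..n} \<Longrightarrow> g (t i) = u i"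
    by auto
  have out: "outer_face V E \<inter> (V \<union> \<Union>E) = {}"
    unfolding outer_face_def by (rule outside_no_overlap)
  have mem: "a \<in> {1..n}" "b \<in> {1..n}" "c \<in> {1..n}" "d \<in> {1..n}" using abcd by auto
  have ne: "u a \<noteq> u c" "u b \<noteq> u d" using u mem abcd unfolding inj_on_def by (metis less_irrefl less_trans)+
  obtain p where p: "arc p" "path_image p \<subseteq> K" "pathstart p = u a" "pathfinish p = u c"
    using K(1-3) ne unfolding path_connected_arcwise by blast
  obtain q where q: "arc q" "path_image q \<subseteq> L" "pathstart q = u b" "pathfinish q = u d"
    using L(1-3) ne unfolding path_connected_arcwise by blast
  have onto: "u i \<in> path_image g" if "i \<in> {1..n}" for i
    using t that by (auto simp: path_image_def image_subset_iff intro!: image_eqI[of _ g "t i"] less_imp_le)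
  have pg: "path_image p \<inter> path_image g = {u a, u c}"
  proof
    show "path_image p \<inter> path_image g \<subseteq> {u a, u c}"
    proof
      fix z assume "z \<in> path_image p \<inter> path_image g"
      then have "z \<in> K" "z \<in> path_image g" using p(2) by auto
      then have "z \<in> K \<inter> u ` {1..n}" using K(5) g(3) out by auto
      then show "z \<in> {u a, u c}" unfolding K(4) .
    qed
    show "{u a, u c} \<subseteq> path_image p \<inter> path_image g"
      using onto mem p(3,4) pathstart_in_path_image[of p] pathfinish_in_path_image[of p] by auto
  qed
  have qg: "path_image q \<inter> path_image g = {u b, u d}"
  proof
    show "path_image q \<inter> path_image g \<subseteq> {u b, u d}"
    proof
      fix z assume "z \<in> path_image q \<inter> path_image g"
      then have "z \<in> L" "z \<in> path_image g" using q(2) by auto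
      then have "z \<in> L \<inter> u ` {1..n}" using L(5) g(3) out by auto
      then show "z \<in> {u b, u d}" unfolding L(4) .
    qed
    show "{u b, u d} \<subseteq> path_image q \<inter> path_image g"
      using onto mem q(3,4) pathstart_in_path_image[of q] pathfinish_in_path_image[of q] by auto
  qed
  have lt: "t a < t b" "t b < t c" "t c < t d"
    using t(1) mem abcd by (auto intro: strict_mono_onD)
  show False
  proof (rule chord_crossing[OF g(1,2), of "t a" "t b" "t c" "t d" p q])
    show "0 \<le> t a" "t d < 1" using t(2) mem by (meson atLeastLessThan_iff image_subset_iff)+
    show "t a < t b" "t b < t c" "t c < t d" by (fact lt)+
    show "arc p" "arc q" by (fact p q)+
    show "pathstart p = g (t a)" "pathfinish p = g (t c)" "pathstart q = g (t b)" "pathfinish q = g (t d)"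
      using p q t(3) mem by auto
    show "path_image p \<inter> path_image g = {g (t a), g (t c)}" "path_image q \<inter> path_image g = {g (t b), g (t d)}"
      using pg qg t(3) mem by auto
    show "path_image p \<subseteq> path_image g \<union> inside (path_image g)"
      "path_image q \<subseteq> path_image g \<union> inside (path_image g)"
      using p(2) q(2) K(5) L(5) g(4) by blast+
    show "path_image p \<inter> path_image q = {}" using p(2) q(2) \<open>K \<inter> L = {}\<close> by blast
  qed
qed

text \<open>A path from \<open>u i\<close> to \<open>u k\<close> may run through further nodes and
  so touch the enclosing curve several times. It is replaced by a piece that meets no node except at
  its ends, and the labels of these ends have to be made to alternate anew.\<close>

lemma matchgate_noncrossing:
  assumes "matchgate V E n u"
  shows "noncrossing V E n u"
  unfolding noncrossing_def
proof (intro allI impI, rule ccontr)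
  fix H i j k l
  assume H: "H \<subseteq> E" and ijkl: "1 \<le> i" "i < j" "j < k" "k < l" "l \<le> (n::nat)"
    and ik: "u k \<in> graph_component V H (u i)" and jl: "u l \<in> graph_component V H (u j)"
    and ij: "u j \<notin> graph_component V H (u i)"
  have G: "plane_graph V E" "inj_on u {1..n}" "u ` {1..n} \<subseteq> V" "clockwise_on_outer_face V E n u"
    using assms unfolding matchgate_def by auto
  define C where "C = graph_component V H (u i)"
  define D where "D = graph_component V H (u j)"
  have mem: "i \<in> {1..n}" "j \<in> {1..n}" "k \<in> {1..n}" "l \<in> {1..n}" using ijkl by auto
  have CD: "C \<inter> D = {}"
  proof (rule ccontr)
    assume "C \<inter> D \<noteq> {}"
    then obtain z where "z \<in> C" "z \<in> D" by blast
    then have "D = C" unfolding C_def D_def using graph_component_eq[of z V H] by metis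
    then show False using ij unfolding C_def D_def by (metis graph_component_refl)
  qed
  have CV: "C \<subseteq> V" "D \<subseteq> V" unfolding C_def D_def using G(3) mem by (auto intro!: graph_component_subset)
  have Ck: "C = graph_component V H (u k)" and Dl: "D = graph_component V H (u l)"
    unfolding C_def D_def using graph_component_eq[OF ik] graph_component_eq[OF jl] by simp_all
  have uC: "u i \<in> C" "u k \<in> C" "u j \<in> D" "u l \<in> D" using ik jl unfolding C_def D_def by auto
  let ?R = "\<lambda>C. C \<union> \<Union>{e \<in> H. e \<inter> V \<subseteq> C}"
  have RE: "?R C \<subseteq> V \<union> \<Union>E" "?R D \<subseteq> V \<union> \<Union>E" using CV H by blast+
  have RR: "?R C \<inter> ?R D = {}"
  proof -
    have "e \<inter> e' \<subseteq> V" if "e \<in> H" "e' \<in> H" "e \<inter> V \<subseteq> C" "e' \<inter> V \<subseteq> D" for e e'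
    proof (cases "e = e'")
      case True
      then have "e \<inter> V = {}" using that CD by blast
      moreover have "e \<in> E" using that H by blast
      then have "e \<inter> V \<noteq> {}" using G(1) unfolding plane_graph_def by fastforce
      ultimately show ?thesis by blast
    next
      case False
      moreover have "e \<in> E" "e' \<in> E" using that H by auto
      ultimately show ?thesis using G(1) unfolding plane_graph_def by blast
    qed
    then have "e \<inter> e' = {}" if "e \<in> H" "e' \<in> H" "e \<inter> V \<subseteq> C" "e' \<inter> V \<subseteq> D" for e e'
      using that CD by blast
    then show ?thesis using CD CV by blast
  qed
  \<comment> \<open>\<open>k\<close> lies strictly between \<open>j\<close> and \<open>l\<close>,
    and \<open>i\<close> does not. So some piece of the first component joins a label in this
    interval to one outside; as the components are disjoint, its ends are not \<open>j\<close> or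
    \<open>l\<close>.\<close>
  have I1: "{j<..<l} \<subseteq> {1..n}" "k \<in> {j<..<l}" "i \<in> {1..n} - {j<..<l}" using ijkl by auto
  obtain i' k' K where K: "i' \<in> {j<..<l}" "k' \<in> {1..n} - {j<..<l}" "u i' \<in> C" "u k' \<in> C" "path_connected K"
    "u i' \<in> K" "u k' \<in> K" "K \<inter> u ` {1..n} = {u i', u k'}" "K \<subseteq> ?R C"
    using crossing_segment[OF G(1) H G(2,3) I1 Ck uC(1)] by blast
  have k'ne: "k' \<noteq> j" "k' \<noteq> l" using K(4) uC CD by auto
  define p where "p = min i' k'"
  define q where "q = max i' k'"
  have pq: "p < q" "1 \<le> p" "q \<le> n" using K(1,2) I1 unfolding p_def q_def by auto
  have upq: "u p \<in> C" "u q \<in> C" "u p \<in> K" "u q \<in> K" "K \<inter> u ` {1..n} = {u p, u q}"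
    using K unfolding p_def q_def min_def max_def by auto
  have I2: "{p<..<q} \<subseteq> {1..n}" using pq by auto
  \<comment> \<open>The labels \<open>p\<close> and \<open>q\<close> separate \<open>j\<close> from
    \<open>l\<close>. So the second component has nodes on both sides, and one of its pieces joins
    the two sides.\<close>
  obtain s s' where s: "s \<in> {p<..<q}" "s' \<in> {1..n} - {p<..<q}" "D = graph_component V H (u s)" "u s' \<in> D"
  proof (cases "k' < j")
    case True
    then have "j \<in> {p<..<q}" "l \<in> {1..n} - {p<..<q}" using K(1,2) mem by (auto simp: p_def q_def)
    then show ?thesis using that D_def uC by blast
  next
    case False
    then have "l < k'" using K(2) k'ne by auto
    then have "l \<in> {p<..<q}" "j \<in> {1..n} - {p<..<q}" using K(1,2) mem by (auto simp: p_def q_def)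
    then show ?thesis using that Dl uC by blast
  qed
  obtain j' l' L where L: "j' \<in> {p<..<q}" "l' \<in> {1..n} - {p<..<q}" "u j' \<in> D" "u l' \<in> D" "path_connected L"
    "u j' \<in> L" "u l' \<in> L" "L \<inter> u ` {1..n} = {u j', u l'}" "L \<subseteq> ?R D"
    using crossing_segment[OF G(1) H G(2,3) I2 s] by blast
  have l'ne: "l' \<noteq> p" "l' \<noteq> q" using L(4) upq CD by auto
  have KL: "K \<inter> L = {}" "K \<subseteq> V \<union> \<Union>E" "L \<subseteq> V \<union> \<Union>E" using K(9) L(9) RR RE by blast+
  show False
  proof (cases "l' < p")
    case True
    show False
      by (rule clockwise_no_crossing[OF G(4,2), of l' p j' q L K])
        (use True L K upq KL pq in \<open>auto simp: insert_commute\<close>)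
  next
    case False
    then have "q < l'" using L(2) l'ne by auto
    then show False
      by (intro clockwise_no_crossing[OF G(4,2), of p j' q l' K L])
        (use L K upq KL pq in \<open>auto simp: insert_commute\<close>)
  qed
qed

lemma matchgate_signature_identities:
  assumes "matchgate V E n u"
  shows "matchgate_identities id {1..n} (\<lambda>S. PM (V - u ` S) {e \<in> E. e \<inter> u ` S = {}} w)"
proof (rule noncrossing_matchgate_identities)
  have G: "plane_graph V E" using assms by (simp add: matchgate_def)
  show "finite V" "finite E" using G by (auto simp: plane_graph_def)
  show "inj_on u {1..n}" "u ` {1..n} \<subseteq> V" using assms by (auto simp: matchgate_def)
  show "noncrossing V E n u" using assms by (rule matchgate_noncrossing)
  fix e assume "e \<in> E"
  then obtain g where "arc g" "e \<inter> V = {pathstart g, pathfinish g}" using G unfolding plane_graph_def by meson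
  then show "\<exists>a b. a \<noteq> b \<and> e \<inter> V = {a,b}" using arc_distinct_ends by blast
qed

section \<open>Straight graphs in a strip\<close>

definition node :: "real \<Rightarrow> nat \<Rightarrow> complex" where
  "node h k = Complex (real k) h"

lemma node_simps [simp]: "Re (node h k) = real k" "Im (node h k) = h" "node h k = node h' k' \<longleftrightarrow> h = h' \<and> k = k'"
  by (auto simp: node_def)

text \<open>The graph reaches the top line of its strip only at the external nodes. So every node
  can be approached from above, and a layer can be put on top that meets the old graph in these
  nodes only.\<close>

definition strip_graph :: "nat \<Rightarrow> real \<Rightarrow> complex set \<Rightarrow> complex set set \<Rightarrow> bool" where
  "strip_graph n h V E \<longleftrightarrow> finite V \<and> finite E \<and> node h ` {1..n} \<subseteq> V \<and>
     (\<forall>e\<in>E. \<exists>a b. a \<noteq> b \<and> e = closed_segment a b \<and> e \<inter> V = {a,b}) \<and>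
     (\<forall>e\<in>E. \<forall>e'\<in>E. e \<noteq> e' \<longrightarrow> e \<inter> e' \<subseteq> V \<and> e \<inter> V \<noteq> e' \<inter> V) \<and>
     (\<forall>z\<in>V \<union> \<Union>E. 1 \<le> Re z \<and> Re z \<le> real n \<and> 0 \<le> Im z \<and> Im z \<le> h \<and> (Im z = h \<longrightarrow> z \<in> node h ` {1..n}))"

lemma strip_graph_bounds:
  assumes "strip_graph n h V E" "z \<in> V \<union> \<Union>E"
  shows "1 \<le> Re z" "Re z \<le> real n" "0 \<le> Im z" "Im z \<le> h" "Im z = h \<Longrightarrow> z \<in> node h ` {1..n}"
proof -
  have "\<forall>z\<in>V \<union> \<Union>E. 1 \<le> Re z \<and> Re z \<le> real n \<and> 0 \<le> Im z \<and> Im z \<le> h \<and> (Im z = h \<longrightarrow> z \<in> node h ` {1..n})"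
    using assms(1) unfolding strip_graph_def by (elim conjE)
  from bspec[OF this assms(2)]
  show "1 \<le> Re z" "Re z \<le> real n" "0 \<le> Im z" "Im z \<le> h" "Im z = h \<Longrightarrow> z \<in> node h ` {1..n}"
    by simp_all
qed

lemma strip_graph_edge:
  assumes "strip_graph n h V E" "e \<in> E"
  obtains a b where "a \<noteq> b" "e = closed_segment a b" "e \<inter> V = {a,b}"
proof -
  have "\<forall>e\<in>E. \<exists>a b. a \<noteq> b \<and> e = closed_segment a b \<and> e \<inter> V = {a,b}"
    using assms(1) unfolding strip_graph_def by (elim conjE)
  from bspec[OF this assms(2)] show ?thesis using that by (elim exE conjE)
qed

lemma strip_graph_edges:
  assumes "strip_graph n h V E" "e \<in> E" "e' \<in> E" "e \<noteq> e'"
  shows "e \<inter> e' \<subseteq> V" "e \<inter> V \<noteq> e' \<inter> V"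
proof -
  have "\<forall>e\<in>E. \<forall>e'\<in>E. e \<noteq> e' \<longrightarrow> e \<inter> e' \<subseteq> V \<and> e \<inter> V \<noteq> e' \<inter> V"
    using assms(1) unfolding strip_graph_def by (elim conjE)
  from bspec[OF bspec[OF this assms(2)] assms(3)] assms(4)
  show "e \<inter> e' \<subseteq> V" "e \<inter> V \<noteq> e' \<inter> V" by simp_all
qed

text \<open>A point off a convex set containing the graph lies in the outer face. The remaining
  points of the top line are joined to such a point by a vertical segment.\<close>

lemma strip_graph_outer_face:
  assumes G: "strip_graph n h V E" and z: "Im z \<ge> h \<or> Im z < 0 \<or> Re z < 1 \<or> Re z > real n"
    "z \<notin> node h ` {1..n}"
  shows "z \<in> outer_face V E"
proof -
  let ?S = "V \<union> \<Union>E"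
  have S: "1 \<le> Re y" "Re y \<le> real n" "0 \<le> Im y" "Im y \<le> h" "Im y = h \<Longrightarrow> y \<in> node h ` {1..n}"
    if "y \<in> ?S" for y using strip_graph_bounds[OF G that] by simp_all
  have half: "y \<in> outside ?S" if "convex T" "y \<notin> T" "\<And>x. x \<in> ?S \<Longrightarrow> x \<in> T" for T y
    using outside_subset_convex[of T ?S] that by blast
  have up: "y \<in> outside ?S" if "Im y > h" for y
    by (rule half[OF convex_halfspace_Im_le[of h]]) (use that S(4) in simp_all)
  consider "Im z > h" | "Im z = h" | "Im z < 0" | "Re z < 1" | "Re z > real n"
    using z by linarith
  then show ?thesis
    unfolding outer_face_def
  proof cases
    case 1
    then show "z \<in> outside ?S" by (rule up)
  next
    case 2
    have "closed_segment (z + \<i>) z \<subseteq> - ?S"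
    proof
      fix y assume "y \<in> closed_segment (z + \<i>) z"
      then have y: "Re y = Re z" "Im y \<in> closed_segment (Im z + 1) (Im z)"
        by (auto simp: closed_segment_same_Re)
      show "y \<in> - ?S"
      proof
        assume "y \<in> ?S"
        moreover from this have "Im y = h" using S(4)[of y] y(2) 2 by (auto simp: closed_segment_eq_real_ivl)
        ultimately have "y \<in> node h ` {1..n}" using S(5) by blast
        moreover have "y = z" using y(1) \<open>Im y = h\<close> 2 by (simp add: complex_eq_iff)
        ultimately show False using z by simp
      qed
    qed
    then have "connected_component (- ?S) (z + \<i>) z"
      unfolding connected_component_def by (intro exI[of _ "closed_segment (z + \<i>) z"]) auto
    then show "z \<in> outside ?S"
      by (rule outside_same_component) (use up 2 in auto)
  next
    case 3
    then show "z \<in> outside ?S"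
      by (intro half[OF convex_halfspace_Im_ge[of 0]]) (use S(3) in simp_all)
  next
    case 4
    then show "z \<in> outside ?S"
      by (intro half[OF convex_halfspace_Re_ge[of 1]]) (use S(1) in simp_all)
  next
    case 5
    then show "z \<in> outside ?S"
      by (intro half[OF convex_halfspace_Re_le[of "real n"]]) (use S(2) in simp_all)
  qed
qed

text \<open>The enclosing curve is the boundary of \<open>[0,n+1] \<times> [-1,h]\<close>, run through clockwise; on the top
  edge the node \<open>k\<close> is reached at time \<open>(1 + k/(n+1))/8\<close>.\<close>

lemma strip_graph_matchgate:
  assumes G: "strip_graph n h V E" and h: "h \<ge> 0"
  shows "matchgate V E n (node h)"
proof -
  let ?S = "V \<union> \<Union>E"
  define a1 where "a1 = Complex 0 (-1)"
  define a3 where "a3 = Complex (real n + 1) h"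
  define R where "R = rectpath a1 a3"
  \<comment> \<open>Inside, \<open>rectpath\<close> has winding number 1; clockwise order requires
    the reverse.\<close>
  define g where "g = reversepath R"
  have S: "1 \<le> Re y" "Re y \<le> real n" "0 \<le> Im y" "Im y \<le> h"
    if "y \<in> ?S" for y using strip_graph_bounds[OF G that] by simp_all
  have R: "simple_path R" "path R" "pathstart R = a1" "pathfinish R = a1"
    unfolding R_def using h by (auto simp: a1_def a3_def)
  have Rim: "path_image R = cbox a1 a3 - box a1 a3"
    unfolding R_def using h by (intro path_image_rectpath_cbox_minus_box) (auto simp: a1_def a3_def)
  have gim: "path_image g = path_image R" by (simp add: g_def)
  have wn: "winding_number R z = 1" if "z \<in> box a1 a3" for z
    unfolding R_def using that by (rule winding_number_rectpath)
  have box: "inside (path_image R) = box a1 a3"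
  proof
    show "inside (path_image R) \<subseteq> box a1 a3"
    proof
      fix z assume z: "z \<in> inside (path_image R)"
      have "- cbox a1 a3 \<subseteq> outside (path_image R)"
        by (rule outside_subset_convex) (auto simp: Rim)
      moreover have "z \<notin> outside (path_image R)" using z inside_Int_outside by blast
      moreover have "z \<notin> path_image R" using z inside_no_overlap by blast
      ultimately show "z \<in> box a1 a3" unfolding Rim by blast
    qed
    show "box a1 a3 \<subseteq> inside (path_image R)"
    proof
      fix z assume z: "z \<in> box a1 a3"
      have "z \<notin> outside (path_image R)"
        using winding_number_zero_in_outside[OF R(2), of z] wn[OF z] R by auto
      moreover have "z \<notin> path_image R" using z unfolding Rim by blast
      ultimately show "z \<in> inside (path_image R)" using inside_Un_outside[of "path_image R"] by blast
    qed
  qed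
  define t where "t k = (1 + real k / (real n + 1)) / 8" for k
  have gt: "g (t k) = node h k" if "k \<in> {1..n}" for k
  proof -
    define s where "s = 1 - real k / (real n + 1)"
    have s: "0 < s" "s \<le> 1" using that by (auto simp: s_def)
    \<comment> \<open>The four sides of \<open>rectpath\<close> end at times 1/2, 3/4, 7/8 and 1.
      The third is the top one, run from right to left from 6/8 to 7/8, so \<open>s\<close> is the
      fraction of it covered before reaching the node.\<close>
    have "g (t k) = R ((6 + s) / 8)"
      unfolding g_def reversepath_def t_def s_def by (rule arg_cong[of _ _ R]) (simp add: field_simps)
    also have "\<dots> = linepath a3 (Complex (Re a1) (Im a3)) s"
      using s by (simp add: R_def rectpath_def Let_def joinpaths_def field_simps)
    also have "\<dots> = node h k"
    proof -
      have "(1 - s) * (real n + 1) = real k" by (simp add: s_def)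
      moreover have "linepath a3 (Complex (Re a1) (Im a3)) s = Complex ((1 - s) * (real n + 1)) h"
        by (simp add: linepath_def complex_eq_iff a1_def a3_def algebra_simps)
      ultimately show ?thesis by (simp add: node_def)
    qed
    finally show ?thesis .
  qed
  have "clockwise_on_outer_face V E n (node h)"
    unfolding clockwise_on_outer_face_def
  proof (rule exI[of _ g], rule exI[of _ t], intro conjI ballI)
    show "simple_path g" using R by (simp add: g_def simple_path_reversepath)
    show "pathfinish g = pathstart g" using R by (simp add: g_def)
    show "winding_number g z = - 1" if "z \<in> inside (path_image g)" for z
    proof -
      have z: "z \<in> box a1 a3" using that box gim by simp
      moreover have "z \<notin> path_image R" using z unfolding Rim by blast
      ultimately show ?thesis using wn R(2) by (simp add: g_def winding_number_reversepath)
    qed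
    show "path_image g \<subseteq> outer_face V E \<union> node h ` {1..n}"
    proof
      fix z assume "z \<in> path_image g"
      then have "z \<in> cbox a1 a3 - box a1 a3" using gim Rim by simp
      then have "Im z \<ge> h \<or> Im z < 0 \<or> Re z < 1 \<or> Re z > real n"
        by (auto simp: in_cbox_complex_iff in_box_complex_iff a1_def a3_def)
      then show "z \<in> outer_face V E \<union> node h ` {1..n}"
        using strip_graph_outer_face[OF G] by blast
    qed
    show "?S \<subseteq> path_image g \<union> inside (path_image g)"
    proof
      fix z assume "z \<in> ?S"
      then have "z \<in> cbox a1 a3"
        using S[of z] by (auto simp: in_cbox_complex_iff a1_def a3_def)
      then show "z \<in> path_image g \<union> inside (path_image g)"
        unfolding gim box by (auto simp: Rim)
    qed
    show "strict_mono_on {1..n} t"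
      by (auto simp: strict_mono_on_def t_def divide_strict_right_mono)
    show "t ` {1..n} \<subseteq> {0..<1}"
      by (auto simp: t_def field_simps)
  qed (use gt in auto)
  moreover have "plane_graph V E"
    unfolding plane_graph_def
  proof (intro conjI ballI)
    show "finite V" "finite E" using G by (auto simp: strip_graph_def)
    fix e assume "e \<in> E"
    then obtain a b where "a \<noteq> b" "e = closed_segment a b" "e \<inter> V = {a,b}"
      using strip_graph_edge[OF G] by blast
    then show "\<exists>g. arc g \<and> path_image g = e \<and> e \<inter> V = {pathstart g, pathfinish g}"
      by (intro exI[of _ "linepath a b"]) auto
  next
    fix e e' assume "e \<in> E" "e' \<in> E"
    then show "e \<noteq> e' \<longrightarrow> e \<inter> e' \<subseteq> V \<and> e \<inter> V \<noteq> e' \<inter> V"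
      using strip_graph_edges[OF G] by simp
  qed
  moreover have "node h ` {1..n} \<subseteq> V" using G by (simp add: strip_graph_def)
  moreover have "node h ` {1..n} \<subseteq> frontier (outer_face V E)"
  proof
    fix z assume z: "z \<in> node h ` {1..n}"
    then have "z \<in> ?S" using \<open>node h ` {1..n} \<subseteq> V\<close> by blast
    then have "z \<notin> outer_face V E" unfolding outer_face_def using outside_no_overlap[of ?S] by blast
    then have "z \<notin> interior (outer_face V E)" using interior_subset by blast
    moreover have "z \<in> closure (outer_face V E)"
      unfolding closure_approachable
    proof (intro allI impI)
      fix \<epsilon> :: real assume "\<epsilon> > 0"
      then have "z + of_real (\<epsilon> / 2) * \<i> \<in> outer_face V E"
        using z by (intro strip_graph_outer_face[OF G]) (auto simp: complex_eq_iff)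
      moreover have "dist (z + of_real (\<epsilon> / 2) * \<i>) z < \<epsilon>"
        using \<open>\<epsilon> > 0\<close> by (simp add: dist_norm norm_mult)
      ultimately show "\<exists>y\<in>outer_face V E. dist y z < \<epsilon>" by blast
    qed
    ultimately show "z \<in> frontier (outer_face V E)" by (simp add: frontier_def)
  qed
  moreover have "inj_on (node h) {1..n}" by (auto simp: inj_on_def)
  ultimately show ?thesis by (simp add: matchgate_def)
qed

section \<open>Adding a layer to a graph in a strip\<close>

text \<open>A matching splits uniquely into its new edges \<open>K\<close> and its old edges. Old
  edges avoid \<open>W\<close>, so \<open>K\<close> has to cover \<open>W - X\<close> by itself, and
  the old edges form a perfect matching of \<open>V\<close> without the vertices that
  \<open>K\<close> already uses.\<close>

lemma PM_extend:
  assumes fin: "finite E" "finite N" and VW: "V \<inter> W = {}" "X \<subseteq> W"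
    and EN: "\<And>e. e \<in> E \<Longrightarrow> e \<inter> W = {}" "E \<inter> N = {}"
  defines "\<K> \<equiv> {K. K \<subseteq> N \<and> (\<forall>e\<in>K. e \<inter> X = {}) \<and> (\<forall>v\<in>W - X. \<exists>!e. e \<in> K \<and> v \<in> e)
      \<and> (\<forall>v\<in>V. \<forall>e\<in>K. \<forall>e'\<in>K. v \<in> e \<longrightarrow> v \<in> e' \<longrightarrow> e = e')}"
  shows "PM (V \<union> W - X) {e \<in> E \<union> N. e \<inter> X = {}} w
    = (\<Sum>K\<in>\<K>. prod w K * PM (V - \<Union>K \<inter> V) {e \<in> E. e \<inter> (\<Union>K \<inter> V) = {}} w)"
proof -
  define MM where "MM K = matchings_missing V E (\<Union>K \<inter> V)" for K
  define L where "L = perfect_matchings (V \<union> W - X) {e \<in> E \<union> N. e \<inter> X = {}}"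
  have fK: "finite \<K>" unfolding \<K>_def by (rule finite_subset[of _ "Pow N"]) (use fin in auto)
  have fM: "finite (MM K)" for K
    unfolding MM_def perfect_matchings_def by (rule finite_subset[of _ "Pow E"]) (use fin in auto)
  have VX: "V - X = V" using VW by blast
  have split: "K \<union> M \<in> L" "(K \<union> M) \<inter> N = K" "(K \<union> M) \<inter> E = M" "K \<inter> M = {}" "K \<subseteq> N" "M \<subseteq> E"
    if "K \<in> \<K>" "M \<in> MM K" for K M
  proof -
    from that(1) have K': "K \<subseteq> N" "\<forall>e\<in>K. e \<inter> X = {}" "\<forall>v\<in>W - X. \<exists>!e. e \<in> K \<and> v \<in> e"
      "\<forall>v\<in>V. \<forall>e\<in>K. \<forall>e'\<in>K. v \<in> e \<longrightarrow> v \<in> e' \<longrightarrow> e = e'"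
      unfolding \<K>_def mem_Collect_eq by - (elim conjE, assumption)+
    then have K: "K \<subseteq> N" "\<And>e. e \<in> K \<Longrightarrow> e \<inter> X = {}" "\<And>v. v \<in> W - X \<Longrightarrow> \<exists>!e. e \<in> K \<and> v \<in> e"
      "\<And>v e e'. v \<in> V \<Longrightarrow> e \<in> K \<Longrightarrow> e' \<in> K \<Longrightarrow> v \<in> e \<Longrightarrow> v \<in> e' \<Longrightarrow> e = e'"
      by - (assumption, erule bspec, assumption, erule bspec, assumption, blast)
    have M: "M \<subseteq> E" "\<And>e. e \<in> M \<Longrightarrow> e \<inter> (\<Union>K \<inter> V) = {}" "\<And>v. v \<in> V - \<Union>K \<inter> V \<Longrightarrow> \<exists>!e. e \<in> M \<and> v \<in> e"
    proof -
      note M = that(2)[unfolded MM_def perfect_matchings_def mem_Collect_eq]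
      show "M \<subseteq> E" using conjunct1[OF M] by auto
      show "e \<inter> (\<Union>K \<inter> V) = {}" if "e \<in> M" for e using subsetD[OF conjunct1[OF M] that] by simp
      show "\<exists>!e. e \<in> M \<and> v \<in> e" if "v \<in> V - \<Union>K \<inter> V" for v using bspec[OF conjunct2[OF M] that] .
    qed
    show "K \<subseteq> N" "M \<subseteq> E" by fact+
    show "(K \<union> M) \<inter> N = K" "(K \<union> M) \<inter> E = M" "K \<inter> M = {}" using K(1) M(1) EN(2) by blast+
    have "K \<union> M \<subseteq> {e \<in> E \<union> N. e \<inter> X = {}}" using K(1,2) M(1) EN(1) VW(2) by blast
    moreover have "\<exists>!e. e \<in> K \<union> M \<and> v \<in> e" if v: "v \<in> V \<union> W - X" for v
    proof -
      consider "v \<in> W - X" | "v \<in> V" "v \<in> \<Union>K" | "v \<in> V - \<Union>K \<inter> V" using v by blast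
      then show ?thesis
      proof cases
        case 1
        then have "e \<in> K \<union> M \<and> v \<in> e \<longleftrightarrow> e \<in> K \<and> v \<in> e" for e using M(1) EN(1) by blast
        then show ?thesis using K(3)[OF 1] by simp
      next
        case 2
        then obtain e where e: "e \<in> K" "v \<in> e" by blast
        show ?thesis
        proof (rule ex1I[of _ e])
          fix e' assume e': "e' \<in> K \<union> M \<and> v \<in> e'"
          then have "e' \<notin> M" using M(2) 2 by blast
          then show "e' = e" using e' K(4)[OF 2(1)] e by blast
        qed (use e in blast)
      next
        case 3
        then have "e \<in> K \<union> M \<and> v \<in> e \<longleftrightarrow> e \<in> M \<and> v \<in> e" for e by blast
        then show ?thesis using M(3)[OF 3] by simp
      qed
    qed
    ultimately show "K \<union> M \<in> L" unfolding L_def perfect_matchings_def by blast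
  qed
  have join: "M \<inter> N \<in> \<K>" "M \<inter> E \<in> MM (M \<inter> N)" "(M \<inter> N) \<union> (M \<inter> E) = M" if "M \<in> L" for M
  proof -
    have M: "M \<subseteq> E \<union> N" "\<And>e. e \<in> M \<Longrightarrow> e \<inter> X = {}" "\<And>v. v \<in> V \<union> W - X \<Longrightarrow> \<exists>!e. e \<in> M \<and> v \<in> e"
    proof -
      note M = that[unfolded L_def perfect_matchings_def mem_Collect_eq]
      show "M \<subseteq> E \<union> N" using conjunct1[OF M] by auto
      show "e \<inter> X = {}" if "e \<in> M" for e using subsetD[OF conjunct1[OF M] that] by simp
      show "\<exists>!e. e \<in> M \<and> v \<in> e" if "v \<in> V \<union> W - X" for v using bspec[OF conjunct2[OF M] that] .
    qed
    show "(M \<inter> N) \<union> (M \<inter> E) = M" using M(1) by blast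
    have u: "e = e'" if "v \<in> V \<union> W - X" "e \<in> M" "e' \<in> M" "v \<in> e" "v \<in> e'" for v e e'
      using M(3)[OF that(1)] that by blast
    have "\<exists>!e. e \<in> M \<inter> N \<and> v \<in> e" if v: "v \<in> W - X" for v
    proof -
      have "e \<in> M \<inter> N \<and> v \<in> e \<longleftrightarrow> e \<in> M \<and> v \<in> e" for e using M(1) EN(1) v by blast
      then show ?thesis using M(3)[of v] v by simp
    qed
    moreover have "\<forall>v\<in>V. \<forall>e\<in>M \<inter> N. \<forall>e'\<in>M \<inter> N. v \<in> e \<longrightarrow> v \<in> e' \<longrightarrow> e = e'"
      using u VX by blast
    ultimately show "M \<inter> N \<in> \<K>" unfolding \<K>_def using M(2) by simp
    have ex: "\<exists>!e. e \<in> M \<inter> E \<and> v \<in> e" if v: "v \<in> V - \<Union>(M \<inter> N) \<inter> V" for v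
    proof -
      have "e \<in> M \<inter> E \<and> v \<in> e \<longleftrightarrow> e \<in> M \<and> v \<in> e" for e using M(1) v by blast
      moreover have "v \<in> V \<union> W - X" using v VX by blast
      ultimately show ?thesis using M(3)[of v] by simp
    qed
    have disj: "e \<inter> (\<Union>(M \<inter> N) \<inter> V) = {}" if e: "e \<in> M \<inter> E" for e
    proof (rule ccontr)
      assume "e \<inter> (\<Union>(M \<inter> N) \<inter> V) \<noteq> {}"
      then obtain v e' where "v \<in> e" "v \<in> V" "e' \<in> M" "e' \<in> N" "v \<in> e'" by blast
      then have "e = e'" using u[of v e e'] e VX by blast
      then show False using e \<open>e' \<in> N\<close> EN(2) by blast
    qed
    show "M \<inter> E \<in> MM (M \<inter> N)"
      unfolding MM_def perfect_matchings_def mem_Collect_eq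
      by (intro conjI ballI subsetI CollectI) (use ex disj in simp_all)
  qed
  have "PM (V \<union> W - X) {e \<in> E \<union> N. e \<inter> X = {}} w = (\<Sum>M\<in>L. prod w M)"
    by (simp add: PM_def L_def)
  also have "\<dots> = (\<Sum>(K,M)\<in>Sigma \<K> MM. prod w K * prod w M)"
  proof (rule sum.reindex_bij_witness[of _ "\<lambda>(K,M). K \<union> M" "\<lambda>M. (M \<inter> N, M \<inter> E)"])
    fix M assume M: "M \<in> L"
    show "(case (M \<inter> N, M \<inter> E) of (K, M) \<Rightarrow> K \<union> M) = M" "(M \<inter> N, M \<inter> E) \<in> Sigma \<K> MM"
      using join[OF M] by auto
    have "prod w (M \<inter> N \<union> M \<inter> E) = prod w (M \<inter> N) * prod w (M \<inter> E)"
      using fin EN(2) by (intro prod.union_disjoint) auto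
    then show "(case (M \<inter> N, M \<inter> E) of (K, M) \<Rightarrow> prod w K * prod w M) = prod w M"
      using join(3)[OF M] by simp
  next
    fix KM assume "KM \<in> Sigma \<K> MM"
    then obtain K M where KM: "KM = (K,M)" "K \<in> \<K>" "M \<in> MM K" by blast
    show "((case KM of (K, M) \<Rightarrow> K \<union> M) \<inter> N, (case KM of (K, M) \<Rightarrow> K \<union> M) \<inter> E) = KM"
      "(case KM of (K, M) \<Rightarrow> K \<union> M) \<in> L"
      using split[OF KM(2,3)] KM(1) by simp_all
  qed
  also have "\<dots> = (\<Sum>K\<in>\<K>. \<Sum>M\<in>MM K. prod w K * prod w M)"
    using fK fM by (subst sum.Sigma) auto
  also have "\<dots> = (\<Sum>K\<in>\<K>. prod w K * PM (V - \<Union>K \<inter> V) {e \<in> E. e \<inter> (\<Union>K \<inter> V) = {}} w)"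
    by (simp add: PM_def MM_def sum_distrib_left)
  finally show ?thesis .
qed

section \<open>Geometry of a layer put on top of a strip\<close>

definition lower :: "real \<Rightarrow> nat \<Rightarrow> complex set" where
  "lower h k = closed_segment (node h k) (node (h + 1) k)"

definition upper :: "real \<Rightarrow> nat \<Rightarrow> complex set" where
  "upper h k = closed_segment (node (h + 1) k) (node (h + 2) k)"

definition rung :: "real \<Rightarrow> nat \<Rightarrow> complex set" where
  "rung h i = closed_segment (node (h + 1) i) (node (h + 1) (Suc i))"

definition diag :: "real \<Rightarrow> nat \<Rightarrow> complex set" where
  "diag h i = closed_segment (node h i) (node (h + 1) (Suc i))"

definition layer_nodes :: "nat \<Rightarrow> real \<Rightarrow> complex set" where
  "layer_nodes n h = node (h + 1) ` {1..n} \<union> node (h + 2) ` {1..n}"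

text \<open>Two vertical edges per label make the layer neutral: if the top node is missing, the
  middle vertex is matched downwards, which removes the old node; otherwise it is matched upwards
  and the old node stays. Only \<open>rung h i\<close> and \<open>diag h i\<close> change the
  signature.\<close>

definition layer_edges :: "nat \<Rightarrow> real \<Rightarrow> nat \<Rightarrow> complex set set" where
  "layer_edges n h i = lower h ` {1..n} \<union> upper h ` {1..n} \<union> {rung h i, diag h i}"

lemma mem_lower: "z \<in> lower h k \<longleftrightarrow> Re z = real k \<and> h \<le> Im z \<and> Im z \<le> h + 1"
  by (auto simp: lower_def closed_segment_same_Re closed_segment_eq_real_ivl)

lemma mem_upper: "z \<in> upper h k \<longleftrightarrow> Re z = real k \<and> h + 1 \<le> Im z \<and> Im z \<le> h + 2"
  by (auto simp: upper_def closed_segment_same_Re closed_segment_eq_real_ivl)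

lemma mem_rung: "z \<in> rung h i \<longleftrightarrow> Im z = h + 1 \<and> real i \<le> Re z \<and> Re z \<le> real i + 1"
  by (auto simp: rung_def closed_segment_same_Im closed_segment_eq_real_ivl)

lemma mem_diag: "z \<in> diag h i \<longleftrightarrow> Re z - real i = Im z - h \<and> h \<le> Im z \<and> Im z \<le> h + 1"
proof
  assume "z \<in> diag h i"
  then obtain u where u: "0 \<le> u" "u \<le> 1" and z: "z = (1 - u) *\<^sub>R node h i + u *\<^sub>R node (h + 1) (Suc i)"
    by (auto simp: diag_def in_segment)
  have "Re z = real i + u" "Im z = h + u" unfolding z by (simp_all add: algebra_simps)
  then show "Re z - real i = Im z - h \<and> h \<le> Im z \<and> Im z \<le> h + 1" using u by simp
next
  assume z: "Re z - real i = Im z - h \<and> h \<le> Im z \<and> Im z \<le> h + 1"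
  define u where "u = Im z - h"
  have "z = (1 - u) *\<^sub>R node h i + u *\<^sub>R node (h + 1) (Suc i)"
    using z by (auto simp: complex_eq_iff u_def algebra_simps)
  moreover have "0 \<le> u" "u \<le> 1" using z by (auto simp: u_def)
  ultimately show "z \<in> diag h i" unfolding diag_def in_segment by blast
qed

lemma real_between_Suc: "real i \<le> real k \<and> real k \<le> real i + 1 \<longleftrightarrow> k = i \<or> k = Suc i"
  by linarith

lemma node_mem [simp]:
  "node y k \<in> lower h j \<longleftrightarrow> k = j \<and> h \<le> y \<and> y \<le> h + 1"
  "node y k \<in> upper h j \<longleftrightarrow> k = j \<and> h + 1 \<le> y \<and> y \<le> h + 2"
  "node y k \<in> rung h j \<longleftrightarrow> y = h + 1 \<and> (k = j \<or> k = Suc j)"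
  "node h k \<in> diag h j \<longleftrightarrow> k = j"
  "node (h + 1) k \<in> diag h j \<longleftrightarrow> k = Suc j"
  "node (h + 2) k \<notin> diag h j"
  using real_between_Suc[of j k] by (auto simp: mem_lower mem_upper mem_rung mem_diag)

lemma edge_distinct [simp]:
  "lower h k = lower h j \<longleftrightarrow> k = j" "upper h k = upper h j \<longleftrightarrow> k = j"
  "lower h k \<noteq> upper h j" "upper h k \<noteq> lower h j" "lower h k \<noteq> rung h j" "rung h j \<noteq> lower h k"
  "upper h k \<noteq> rung h j" "rung h j \<noteq> upper h k" "lower h k \<noteq> diag h j" "diag h j \<noteq> lower h k"
  "upper h k \<noteq> diag h j" "diag h j \<noteq> upper h k" "rung h j \<noteq> diag h l" "diag h l \<noteq> rung h j"
proof -
  have "node h k \<in> lower h k" "node (h + 2) k \<in> upper h k" by simp_all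
  then show "lower h k = lower h j \<longleftrightarrow> k = j" "upper h k = upper h j \<longleftrightarrow> k = j"
    by (metis node_mem(1), metis node_mem(2))
  have a: "node h k \<in> lower h k" "node h k \<notin> upper h j" "node h k \<notin> rung h j"
    "node (h + 2) k \<in> upper h k" "node (h + 2) k \<notin> rung h j" "node (h + 2) k \<notin> diag h j"
    "node h l \<in> diag h l" "node h l \<notin> rung h j"
    by simp_all
  show "lower h k \<noteq> upper h j" "lower h k \<noteq> rung h j" "upper h k \<noteq> rung h j" "upper h k \<noteq> diag h j"
    "rung h j \<noteq> diag h l" using a by metis+
  then show "rung h j \<noteq> lower h k" "rung h j \<noteq> upper h k" "diag h j \<noteq> upper h k" "diag h l \<noteq> rung h j"
    by metis+
  have "node h k \<in> upper h k \<longleftrightarrow> False" "node h j \<in> upper h k \<longleftrightarrow> False" by simp_all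
  then show "upper h k \<noteq> lower h j" by (metis node_mem(1) le_add_same_cancel1 order_refl zero_le_one)
  show "lower h k \<noteq> diag h j"
  proof
    assume *: "lower h k = diag h j"
    have "node h k \<in> lower h k" "node (h + 1) k \<in> lower h k" by simp_all
    then have "k = j" "k = Suc j" unfolding * by simp_all
    then show False by simp
  qed
  then show "diag h j \<noteq> lower h k" by metis
qed

text \<open>The layer \<open>u\<^sub>k - w\<^sub>k - v\<^sub>k\<close> of paths from the old nodes \<open>u\<^sub>k\<close> to the new nodes \<open>v\<^sub>k\<close>, with the two
  additional edges \<open>w\<^sub>i w\<^sub>i\<^sub>+\<^sub>1\<close> and \<open>u\<^sub>i w\<^sub>i\<^sub>+\<^sub>1\<close>.\<close>

locale layer =
  fixes n :: nat and h :: real and V E i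
  assumes G: "strip_graph n h V E" and h: "h \<ge> 0" and i: "1 \<le> i" "i < n"
begin

abbreviation "W \<equiv> layer_nodes n h"
abbreviation "N \<equiv> layer_edges n h i"

lemma layer_edge_cases:
  assumes "e \<in> N"
  obtains k where "k \<in> {1..n}" "e = lower h k" | k where "k \<in> {1..n}" "e = upper h k"
    | "e = rung h i" | "e = diag h i"
  using assms unfolding layer_edges_def by blast

lemma edge_Im: "e \<in> N \<Longrightarrow> z \<in> e \<Longrightarrow> h \<le> Im z"
  by (erule layer_edge_cases) (auto simp: mem_lower mem_upper mem_rung mem_diag)

text \<open>New edges lie at height \<open>h\<close> or above, where the old graph has only its
  nodes.\<close>

lemma old_in_edge: "e \<in> N \<Longrightarrow> z \<in> e \<Longrightarrow> z \<in> V \<union> \<Union>E \<Longrightarrow> z \<in> node h ` {1..n}"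
  using strip_graph_bounds(4,5)[OF G, of z] edge_Im[of e z] by auto

lemma node_in_V: "k \<in> {1..n} \<Longrightarrow> node h k \<in> V"
  using G by (auto simp: strip_graph_def)

lemma W_Im: "z \<in> W \<Longrightarrow> Im z > h"
  by (auto simp: layer_nodes_def)

lemma VW: "V \<inter> W = {}"
proof -
  have "Im z \<le> h" if "z \<in> V" for z using strip_graph_bounds(4)[OF G] that by blast
  then show ?thesis using W_Im by force
qed

lemma EW: "e \<in> E \<Longrightarrow> e \<inter> W = {}"
proof -
  assume e: "e \<in> E"
  have "Im z \<le> h" if "z \<in> e" for z using strip_graph_bounds(4)[OF G] that e by blast
  then show ?thesis using W_Im by force
qed

lemma node_in_W [simp]: "node (h + 1) k \<in> W \<longleftrightarrow> k \<in> {1..n}" "node (h + 2) k \<in> W \<longleftrightarrow> k \<in> {1..n}"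
  by (auto simp: layer_nodes_def)

lemma edge_has_W: "e \<in> N \<Longrightarrow> \<exists>z\<in>W. z \<in> e"
proof (erule layer_edge_cases)
  fix k assume "k \<in> {1..n}" "e = lower h k"
  then show ?thesis by (intro bexI[of _ "node (h + 1) k"]) auto
next
  fix k assume "k \<in> {1..n}" "e = upper h k"
  then show ?thesis by (intro bexI[of _ "node (h + 1) k"]) auto
next
  assume "e = rung h i"
  then show ?thesis using i by (intro bexI[of _ "node (h + 1) i"]) auto
next
  assume "e = diag h i"
  then show ?thesis using i by (intro bexI[of _ "node (h + 1) (Suc i)"]) auto
qed

lemma EN: "E \<inter> N = {}"
  using edge_has_W EW by blast

lemma edge_ends:
  "k \<in> {1..n} \<Longrightarrow> lower h k \<inter> (V \<union> W) = {node h k, node (h + 1) k}"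
  "k \<in> {1..n} \<Longrightarrow> upper h k \<inter> (V \<union> W) = {node (h + 1) k, node (h + 2) k}"
  "rung h i \<inter> (V \<union> W) = {node (h + 1) i, node (h + 1) (Suc i)}"
  "diag h i \<inter> (V \<union> W) = {node h i, node (h + 1) (Suc i)}"
proof -
  have *: "e \<inter> (V \<union> W) = e \<inter> (node h ` {1..n} \<union> W)" if "e \<in> N" for e
    using old_in_edge[OF that] node_in_V by blast
  have N: "lower h k \<in> N" "upper h k \<in> N" if "k \<in> {1..n}" for k
    using that by (auto simp: layer_edges_def)
  have N': "rung h i \<in> N" "diag h i \<in> N" by (auto simp: layer_edges_def)
  show "lower h k \<inter> (V \<union> W) = {node h k, node (h + 1) k}" if "k \<in> {1..n}"
    unfolding *[OF N(1)[OF that]] using that by (auto simp: layer_nodes_def)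
  show "upper h k \<inter> (V \<union> W) = {node (h + 1) k, node (h + 2) k}" if "k \<in> {1..n}"
    unfolding *[OF N(2)[OF that]] using that by (auto simp: layer_nodes_def)
  show "rung h i \<inter> (V \<union> W) = {node (h + 1) i, node (h + 1) (Suc i)}"
    unfolding *[OF N'(1)] using i by (auto simp: layer_nodes_def)
  show "diag h i \<inter> (V \<union> W) = {node h i, node (h + 1) (Suc i)}"
    unfolding *[OF N'(2)] using i by (auto simp: layer_nodes_def)
qed

text \<open>For each pair of edge types, a common point has an integer real part and height
  \<open>h\<close> or \<open>h + 1\<close>, and such points are vertices.\<close>

lemma layer_edge_meet:
  assumes "e \<in> N" "e' \<in> N" "e \<noteq> e'" "z \<in> e" "z \<in> e'"
  shows "z \<in> node h ` {1..n} \<union> W"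
proof -
  have I: "z \<in> node h ` {1..n} \<union> W" if "Re z = real k" "Im z = h \<or> Im z = h + 1" "k \<in> {1..n}" for k
  proof -
    have "z = node (Im z) k" using that by (simp add: complex_eq_iff)
    then show ?thesis using that by (metis UnCI imageI node_in_W(1))
  qed
  have n: "i \<in> {1..n}" "Suc i \<in> {1..n}" using i by auto
  let ?Q = "z \<in> node h ` {1..n} \<union> W"
  have LL: "k = k'" if "z \<in> lower h k" "z \<in> lower h k'" for k k'
    using that by (simp add: mem_lower)
  have UU: "k = k'" if "z \<in> upper h k" "z \<in> upper h k'" for k k'
    using that by (simp add: mem_upper)
  have LU: ?Q if "z \<in> lower h k" "z \<in> upper h k'" "k \<in> {1..n}" for k k'
    by (rule I[of k]) (use that in \<open>auto simp: mem_lower mem_upper\<close>)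
  have LR: ?Q if "z \<in> lower h k" "z \<in> rung h i" "k \<in> {1..n}" for k
    by (rule I[of k]) (use that in \<open>auto simp: mem_lower mem_rung\<close>)
  have UR: ?Q if "z \<in> upper h k" "z \<in> rung h i" "k \<in> {1..n}" for k
    by (rule I[of k]) (use that in \<open>auto simp: mem_upper mem_rung\<close>)
  have UD: ?Q if "z \<in> upper h k" "z \<in> diag h i" "k \<in> {1..n}" for k
    by (rule I[of k]) (use that in \<open>auto simp: mem_upper mem_diag\<close>)
  have RD: ?Q if "z \<in> rung h i" "z \<in> diag h i"
    by (rule I[of "Suc i"]) (use that n in \<open>auto simp: mem_rung mem_diag\<close>)
  have LD: ?Q if "z \<in> lower h k" "z \<in> diag h i" "k \<in> {1..n}" for k
  proof -
    have k: "Re z = real k" "real k - real i = Im z - h" "h \<le> Im z" "Im z \<le> h + 1"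
      using that by (auto simp: mem_lower mem_diag)
    then have "k = i \<or> k = Suc i" using real_between_Suc[of i k] by auto
    then show ?thesis using k that(3) by (intro I[of k]) auto
  qed
  show ?thesis
    by (rule layer_edge_cases[OF assms(1)]; rule layer_edge_cases[OF assms(2)])
      (metis assms(3-5) LL UU LU LR UR UD RD LD)+
qed

lemma strip_graph_layer: "strip_graph n (h + 2) (V \<union> W) (E \<union> N)"
  unfolding strip_graph_def
proof (intro conjI ballI impI)
  have fin: "finite V" "finite E" using G by (auto simp: strip_graph_def)
  then show "finite (V \<union> W)" "finite (E \<union> N)" by (auto simp: layer_nodes_def layer_edges_def)
  show "node (h + 2) ` {1..n} \<subseteq> V \<union> W" by auto
  have old: "e \<inter> (V \<union> W) = e \<inter> V" if "e \<in> E" for e using EW[OF that] by blast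
  show "\<exists>a b. a \<noteq> b \<and> e = closed_segment a b \<and> e \<inter> (V \<union> W) = {a,b}" if "e \<in> E \<union> N" for e
  proof (cases "e \<in> E")
    case True
    then show ?thesis using strip_graph_edge[OF G True] old[OF True] by metis
  next
    case False
    then have "e \<in> N" using that by blast
    then show ?thesis
    proof (rule layer_edge_cases)
      fix k assume "k \<in> {1..n}" "e = lower h k"
      then show ?thesis using edge_ends(1)
        by (intro exI[of _ "node h k"] exI[of _ "node (h + 1) k"]) (auto simp: lower_def)
    next
      fix k assume "k \<in> {1..n}" "e = upper h k"
      then show ?thesis using edge_ends(2)
        by (intro exI[of _ "node (h + 1) k"] exI[of _ "node (h + 2) k"]) (auto simp: upper_def)
    next
      assume "e = rung h i"
      then show ?thesis using edge_ends(3)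
        by (intro exI[of _ "node (h + 1) i"] exI[of _ "node (h + 1) (Suc i)"]) (auto simp: rung_def)
    next
      assume "e = diag h i"
      then show ?thesis using edge_ends(4)
        by (intro exI[of _ "node h i"] exI[of _ "node (h + 1) (Suc i)"]) (auto simp: diag_def)
    qed
  qed
  show "e \<inter> e' \<subseteq> V \<union> W" if e: "e \<in> E \<union> N" "e' \<in> E \<union> N" "e \<noteq> e'" for e e'
  proof
    fix z assume z: "z \<in> e \<inter> e'"
    consider "e \<in> E" "e' \<in> E" | "e \<in> N" "e' \<in> N" | "e \<in> E" "e' \<in> N" | "e \<in> N" "e' \<in> E"
      using e by blast
    then show "z \<in> V \<union> W"
    proof cases
      case 1
      then show ?thesis using strip_graph_edges(1)[OF G] e z by blast
    next
      case 2
      then show ?thesis using layer_edge_meet[of e e' z] e z node_in_V by blast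
    next
      case 3
      then show ?thesis using old_in_edge[of e' z] z node_in_V by blast
    next
      case 4
      then show ?thesis using old_in_edge[of e z] z node_in_V by blast
    qed
  qed
  show "e \<inter> (V \<union> W) \<noteq> e' \<inter> (V \<union> W)" if e: "e \<in> E \<union> N" "e' \<in> E \<union> N" "e \<noteq> e'" for e e'
  proof -
    consider "e \<in> E" "e' \<in> E" | "e \<in> N" "e' \<in> N" | "e \<in> E" "e' \<in> N" | "e \<in> N" "e' \<in> E"
      using e by blast
    then show ?thesis
    proof cases
      case 1
      then show ?thesis using strip_graph_edges(2)[OF G 1 e(3)] old by simp
    next
      case 2
      then show ?thesis using e(3)
        by (elim layer_edge_cases) (auto simp: edge_ends doubleton_eq_iff)
    next
      case 3
      then show ?thesis using edge_has_W[of e'] EW[of e] by blast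
    next
      case 4
      then show ?thesis using edge_has_W[of e] EW[of e'] by blast
    qed
  qed
  fix z assume z: "z \<in> V \<union> W \<union> \<Union>(E \<union> N)"
  have "1 \<le> Re z \<and> Re z \<le> real n \<and> 0 \<le> Im z \<and> Im z \<le> h + 2 \<and> (Im z = h + 2 \<longrightarrow> z \<in> node (h + 2) ` {1..n})"
  proof (cases "z \<in> V \<union> \<Union>E")
    case True
    then show ?thesis using strip_graph_bounds[OF G True] by auto
  next
    case False
    have I: "z \<in> node (h + 2) ` {1..n}" if "Re z = real k" "Im z = h + 2" "k \<in> {1..n}" for k
    proof -
      have "z = node (h + 2) k" using that by (simp add: complex_eq_iff)
      then show ?thesis using that by blast
    qed
    consider "z \<in> W" | e where "e \<in> N" "z \<in> e" using z False by blast
    then show ?thesis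
    proof cases
      case 1
      then show ?thesis using h by (auto simp: layer_nodes_def)
    next
      case 2
      then show ?thesis using h i I
        by (elim layer_edge_cases) (auto simp: mem_lower mem_upper mem_rung mem_diag)
    qed
  qed
  then show "1 \<le> Re z" "Re z \<le> real n" "0 \<le> Im z" "Im z \<le> h + 2"
    "Im z = h + 2 \<Longrightarrow> z \<in> node (h + 2) ` {1..n}" by simp_all
qed

end

section \<open>Matchings of the layer and the resulting signature\<close>

context layer
begin

lemma in_u: "e \<in> N \<Longrightarrow> node h k \<in> e \<longleftrightarrow> e = lower h k \<or> e = diag h i \<and> k = i"
  by (erule layer_edge_cases) auto

lemma in_w: "e \<in> N \<Longrightarrow> node (h + 1) k \<in> e \<longleftrightarrow>
    e = lower h k \<or> e = upper h k \<or> e = rung h i \<and> (k = i \<or> k = Suc i) \<or> e = diag h i \<and> k = Suc i"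
  by (erule layer_edge_cases) auto

lemma in_v: "e \<in> N \<Longrightarrow> node (h + 2) k \<in> e \<longleftrightarrow> e = upper h k"
  by (erule layer_edge_cases) auto

text \<open>The sets of new edges that occur in the matchings missing the new nodes with labels in \<open>S\<close>.\<close>

definition covers :: "nat set \<Rightarrow> complex set set set" where
  "covers S = {K. K \<subseteq> N \<and> (\<forall>e\<in>K. e \<inter> node (h + 2) ` S = {})
      \<and> (\<forall>v\<in>W - node (h + 2) ` S. \<exists>!e. e \<in> K \<and> v \<in> e)
      \<and> (\<forall>v\<in>V. \<forall>e\<in>K. \<forall>e'\<in>K. v \<in> e \<longrightarrow> v \<in> e' \<longrightarrow> e = e')}"

text \<open>\<open>upper h k\<close> is the only new edge at a top node, so \<open>S\<close>
  determines which upper edges occur. The only old vertex with two new edges is the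
  \<open>i\<close>-th node, which yields the last condition.\<close>

lemma covers_iff:
  assumes S: "S \<subseteq> {1..n}"
  shows "K \<in> covers S \<longleftrightarrow> K \<subseteq> N \<and> (\<forall>k\<in>{1..n}. upper h k \<in> K \<longleftrightarrow> k \<notin> S)
    \<and> (\<forall>k\<in>{1..n}. \<exists>!e. e \<in> K \<and> node (h + 1) k \<in> e) \<and> \<not> (lower h i \<in> K \<and> diag h i \<in> K)"
    (is "_ \<longleftrightarrow> ?rhs")
proof
  assume "K \<in> covers S"
  then have K: "K \<subseteq> N" "\<forall>e\<in>K. e \<inter> node (h + 2) ` S = {}"
    "\<forall>v\<in>W - node (h + 2) ` S. \<exists>!e. e \<in> K \<and> v \<in> e"
    "\<forall>v\<in>V. \<forall>e\<in>K. \<forall>e'\<in>K. v \<in> e \<longrightarrow> v \<in> e' \<longrightarrow> e = e'"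
    unfolding covers_def mem_Collect_eq by - (elim conjE, assumption)+
  show ?rhs
  proof (intro conjI ballI)
    show "K \<subseteq> N" by fact
    fix k assume k: "k \<in> {1..n}"
    show "\<exists>!e. e \<in> K \<and> node (h + 1) k \<in> e"
      by (rule bspec[OF K(3)]) (use k in auto)
    show "upper h k \<in> K \<longleftrightarrow> k \<notin> S"
    proof
      assume "upper h k \<in> K"
      then have "upper h k \<inter> node (h + 2) ` S = {}" using K(2) by blast
      moreover have "node (h + 2) k \<in> upper h k" by simp
      ultimately show "k \<notin> S" by blast
    next
      assume "k \<notin> S"
      then have "node (h + 2) k \<in> W - node (h + 2) ` S" using k by auto
      then have "\<exists>!e. e \<in> K \<and> node (h + 2) k \<in> e" by (rule bspec[OF K(3)])
      then obtain e where "e \<in> K" "node (h + 2) k \<in> e" by blast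
      then show "upper h k \<in> K" using in_v[of e k] K(1) by auto
    qed
  next
    show "\<not> (lower h i \<in> K \<and> diag h i \<in> K)"
    proof
      assume "lower h i \<in> K \<and> diag h i \<in> K"
      moreover have "node h i \<in> lower h i" "node h i \<in> diag h i" "node h i \<in> V"
        using i by (auto intro!: node_in_V)
      ultimately have "lower h i = diag h i" using K(4) by blast
      then show False by simp
    qed
  qed
next
  assume ?rhs
  then have K: "K \<subseteq> N" "\<forall>k\<in>{1..n}. upper h k \<in> K \<longleftrightarrow> k \<notin> S"
    "\<forall>k\<in>{1..n}. \<exists>!e. e \<in> K \<and> node (h + 1) k \<in> e" "\<not> (lower h i \<in> K \<and> diag h i \<in> K)"
    by - (elim conjE, assumption)+
  show "K \<in> covers S"
    unfolding covers_def mem_Collect_eq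
  proof (intro conjI ballI impI)
    show "K \<subseteq> N" by fact
    show "e \<inter> node (h + 2) ` S = {}" if e: "e \<in> K" for e
    proof (rule ccontr)
      assume "e \<inter> node (h + 2) ` S \<noteq> {}"
      then obtain k where k: "k \<in> S" "node (h + 2) k \<in> e" by blast
      then have "e = upper h k" using in_v[of e k] K(1) e by auto
      then show False using K(2) k S e by blast
    qed
    show "\<exists>!e. e \<in> K \<and> v \<in> e" if v: "v \<in> W - node (h + 2) ` S" for v
    proof -
      consider k where "k \<in> {1..n}" "v = node (h + 1) k" | k where "k \<in> {1..n}" "v = node (h + 2) k" "k \<notin> S"
        using v unfolding layer_nodes_def by blast
      then show ?thesis
      proof cases
        case 1
        then show ?thesis using bspec[OF K(3)] by simp
      next
        case 2
        show ?thesis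
        proof (rule ex1I[of _ "upper h k"])
          show "upper h k \<in> K \<and> v \<in> upper h k" using K(2) 2 by simp
          show "e = upper h k" if "e \<in> K \<and> v \<in> e" for e using in_v[of e k] that K(1) 2 by auto
        qed
      qed
    qed
    fix v e e' assume v: "v \<in> V" "e \<in> K" "e' \<in> K" "v \<in> e" "v \<in> e'"
    have "v \<in> node h ` {1..n}" using old_in_edge[of e v] v K(1) by blast
    then obtain k where "v = node h k" by blast
    then have "e = lower h k \<or> e = diag h i \<and> k = i" "e' = lower h k \<or> e' = diag h i \<and> k = i"
      using in_u[of e k] in_u[of e' k] v K(1) by auto
    then show "e = e'" using K(4) v by auto
  qed
qed

definition cover :: "nat set \<Rightarrow> nat set \<Rightarrow> complex set set \<Rightarrow> complex set set" where
  "cover S T Z = lower h ` T \<union> upper h ` ({1..n} - S) \<union> Z"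

lemma cover_mem:
  assumes "Z \<subseteq> {rung h i, diag h i}"
  shows "lower h k \<in> cover S T Z \<longleftrightarrow> k \<in> T" "upper h k \<in> cover S T Z \<longleftrightarrow> k \<in> {1..n} - S"
    "rung h i \<in> cover S T Z \<longleftrightarrow> rung h i \<in> Z" "diag h i \<in> cover S T Z \<longleftrightarrow> diag h i \<in> Z"
  using assms by (auto simp: cover_def image_iff)

text \<open>\<open>rung h i\<close> uses up the middle vertices of \<open>i\<close> and
  \<open>i + 1\<close>, so both top nodes must be missing. \<open>diag h i\<close> uses up the
  middle vertex of \<open>i + 1\<close> and the old node \<open>i\<close>; the middle vertex of
  \<open>i\<close> then has to go upwards, whence \<open>i \<notin> S\<close>. The two edges share a
  vertex and exclude each other.\<close>

lemma covers_cases: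
  assumes S: "S \<subseteq> {1..n}" and K: "K \<in> covers S"
  shows "K = cover S S {} \<or> i \<in> S \<and> Suc i \<in> S \<and> K = cover S (S - {i, Suc i}) {rung h i}
    \<or> i \<notin> S \<and> Suc i \<in> S \<and> K = cover S (S - {Suc i}) {diag h i}"
proof -
  have N: "K \<subseteq> N" and up: "\<And>k. k \<in> {1..n} \<Longrightarrow> upper h k \<in> K \<longleftrightarrow> k \<notin> S"
    and mid: "\<And>k. k \<in> {1..n} \<Longrightarrow> \<exists>!e. e \<in> K \<and> node (h + 1) k \<in> e"
    and low: "\<not> (lower h i \<in> K \<and> diag h i \<in> K)"
    using K unfolding covers_iff[OF S] by simp_all
  define T where "T = {k \<in> {1..n}. lower h k \<in> K}"
  have eq: "K = cover S T (K \<inter> {rung h i, diag h i})"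
  proof (intro set_eqI iffI)
    fix e assume e: "e \<in> K"
    then have "e \<in> N" using N by blast
    then show "e \<in> cover S T (K \<inter> {rung h i, diag h i})"
      by (rule layer_edge_cases) (use e up in \<open>auto simp: cover_def T_def\<close>)
  next
    fix e assume "e \<in> cover S T (K \<inter> {rung h i, diag h i})"
    then show "e \<in> K" using up by (auto simp: cover_def T_def)
  qed
  have ex: "lower h k \<in> K \<or> upper h k \<in> K \<or> rung h i \<in> K \<and> (k = i \<or> k = Suc i) \<or> diag h i \<in> K \<and> k = Suc i"
    if k: "k \<in> {1..n}" for k
  proof -
    obtain e where e: "e \<in> K" "node (h + 1) k \<in> e" using mid[OF k] by blast
    then show ?thesis using in_w[of e k] N by blast
  qed
  have un: "e = e'" if "k \<in> {1..n}" "e \<in> K" "e' \<in> K" "node (h + 1) k \<in> e" "node (h + 1) k \<in> e'" for k e e'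
    using mid[OF that(1)] that by blast
  have lu: "\<not> (lower h k \<in> K \<and> upper h k \<in> K)" if "k \<in> {1..n}" for k
    using un[OF that, of "lower h k" "upper h k"] by auto
  have n: "i \<in> {1..n}" "Suc i \<in> {1..n}" using i by auto
  have r: "lower h i \<notin> K" "upper h i \<notin> K" "lower h (Suc i) \<notin> K" "upper h (Suc i) \<notin> K" "diag h i \<notin> K"
    if "rung h i \<in> K"
    using un[OF n(1) that, of "lower h i"] un[OF n(1) that, of "upper h i"]
      un[OF n(2) that, of "lower h (Suc i)"] un[OF n(2) that, of "upper h (Suc i)"]
      un[OF n(2) that, of "diag h i"] by auto
  have d: "lower h (Suc i) \<notin> K" "upper h (Suc i) \<notin> K" if "diag h i \<in> K"
    using un[OF n(2) that, of "lower h (Suc i)"] un[OF n(2) that, of "upper h (Suc i)"] by auto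
  consider "rung h i \<in> K" | "diag h i \<in> K" "rung h i \<notin> K" | "rung h i \<notin> K" "diag h i \<notin> K" by blast
  then show ?thesis
  proof cases
    case 1
    have "i \<in> S" "Suc i \<in> S" using r[OF 1] up n by blast+
    moreover have "T = S - {i, Suc i}"
      using r[OF 1] ex up lu S unfolding T_def by blast
    moreover have "K \<inter> {rung h i, diag h i} = {rung h i}" using 1 r by auto
    ultimately show ?thesis using eq by simp
  next
    case 2
    have "lower h i \<notin> K" using 2 low by blast
    then have "upper h i \<in> K" using ex[OF n(1)] 2 by auto
    then have "i \<notin> S" "Suc i \<in> S" using d[OF 2(1)] up n by blast+
    moreover have "T = S - {Suc i}"
      using d[OF 2(1)] ex up lu S 2 unfolding T_def by blast
    moreover have "K \<inter> {rung h i, diag h i} = {diag h i}" using 2 by auto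
    ultimately show ?thesis using eq by simp
  next
    case 3
    have "T = S" using ex up lu S 3 unfolding T_def by blast
    moreover have "K \<inter> {rung h i, diag h i} = {}" using 3 by auto
    ultimately show ?thesis using eq by simp
  qed
qed

text \<open>\<open>g k\<close> is the unique edge at the middle vertex with label
  \<open>k\<close>.\<close>

lemma cover_in_covers:
  assumes S: "S \<subseteq> {1..n}" and T: "T \<subseteq> {1..n}" and Z: "Z \<subseteq> {rung h i, diag h i}"
    and g: "\<And>k. k \<in> {1..n} \<Longrightarrow> g k \<in> cover S T Z \<and> node (h + 1) k \<in> g k"
    and u: "\<And>k e. k \<in> {1..n} \<Longrightarrow> e \<in> cover S T Z \<Longrightarrow> node (h + 1) k \<in> e \<Longrightarrow> e = g k"
    and l: "\<not> (i \<in> T \<and> diag h i \<in> Z)"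
  shows "cover S T Z \<in> covers S"
  unfolding covers_iff[OF S]
proof (intro conjI ballI)
  show "cover S T Z \<subseteq> N" using T Z by (auto simp: cover_def layer_edges_def)
  show "upper h k \<in> cover S T Z \<longleftrightarrow> k \<notin> S" if "k \<in> {1..n}" for k
    using cover_mem[OF Z] that by simp
  show "\<exists>!e. e \<in> cover S T Z \<and> node (h + 1) k \<in> e" if "k \<in> {1..n}" for k
    by (rule ex1I[of _ "g k"]) (use g[OF that] u[OF that] in auto)
  show "\<not> (lower h i \<in> cover S T Z \<and> diag h i \<in> cover S T Z)"
    using cover_mem[OF Z] l by simp
qed

lemma covers_eq:
  assumes S: "S \<subseteq> {1..n}"
  shows "covers S = {cover S S {}}
    \<union> (if i \<in> S \<and> Suc i \<in> S then {cover S (S - {i, Suc i}) {rung h i}} else {})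
    \<union> (if i \<notin> S \<and> Suc i \<in> S then {cover S (S - {Suc i}) {diag h i}} else {})"
proof -
  have "cover S S {} \<in> covers S"
    by (rule cover_in_covers[where g = "\<lambda>k. if k \<in> S then lower h k else upper h k"])
      (use S in \<open>auto simp: cover_def split: if_splits\<close>)
  moreover have "cover S (S - {i, Suc i}) {rung h i} \<in> covers S" if "i \<in> S" "Suc i \<in> S"
    by (rule cover_in_covers[where g = "\<lambda>k. if k \<in> {i, Suc i} then rung h i else if k \<in> S then lower h k else upper h k"])
      (use S that in \<open>auto simp: cover_def split: if_splits\<close>)
  moreover have "cover S (S - {Suc i}) {diag h i} \<in> covers S" if "i \<notin> S" "Suc i \<in> S"
    by (rule cover_in_covers[where g = "\<lambda>k. if k = Suc i then diag h i else if k \<in> S then lower h k else upper h k"])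
      (use S that in \<open>auto simp: cover_def split: if_splits\<close>)
  ultimately show ?thesis using covers_cases[OF S] by auto
qed

text \<open>There is one summand per cover, weighted by its additional edge, and the old nodes used
  by the cover are removed from the old graph. So the rung drops the missing labels \<open>i\<close>
  and \<open>i + 1\<close>, and the diagonal turns a missing \<open>i + 1\<close> into a missing
  \<open>i\<close>.\<close>

lemma layer_signature:
  fixes w :: "complex set \<Rightarrow> complex" and c t :: complex
  assumes S: "S \<subseteq> {1..n}"
  defines "f \<equiv> \<lambda>T. PM (V - node h ` T) {e \<in> E. e \<inter> node h ` T = {}} w"
    and "w' \<equiv> \<lambda>e. if e \<in> E then w e else if e = rung h i then c else if e = diag h i then t else 1"
  shows "PM (V \<union> W - node (h + 2) ` S) {e \<in> E \<union> N. e \<inter> node (h + 2) ` S = {}} w'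
    = f S + (if i \<in> S \<and> Suc i \<in> S then c * f (S - {i, Suc i}) else 0)
      + (if i \<notin> S \<and> Suc i \<in> S then t * f (insert i (S - {Suc i})) else 0)"
proof -
  have finE: "finite E" using G by (simp add: strip_graph_def)
  have finN: "finite N" by (simp add: layer_edges_def)
  have XW: "node (h + 2) ` S \<subseteq> W" using S by auto
  let ?s = "\<lambda>K. prod w' K * PM (V - \<Union>K \<inter> V) {e \<in> E. e \<inter> (\<Union>K \<inter> V) = {}} w'"
  have sum: "PM (V \<union> W - node (h + 2) ` S) {e \<in> E \<union> N. e \<inter> node (h + 2) ` S = {}} w' = sum ?s (covers S)"
    unfolding covers_def by (rule PM_extend[OF finE finN VW XW EW EN])
  have PMw: "PM A {e \<in> E. Q e} w' = PM A {e \<in> E. Q e} w" for A Q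
    unfolding PM_def
  proof (intro sum.cong prod.cong refl)
    fix M e assume "M \<in> perfect_matchings A {e \<in> E. Q e}" "e \<in> M"
    then have "e \<in> E" by (auto simp: perfect_matchings_def)
    then show "w' e = w e" by (simp add: w'_def)
  qed
  have meet: "\<Union>(cover S T Z) \<inter> V = node h ` (if diag h i \<in> Z then insert i T else T)"
    if T: "T \<subseteq> {1..n}" and Z: "Z \<subseteq> {rung h i, diag h i}" for T Z
  proof -
    have sub: "cover S T Z \<subseteq> N" using T Z by (auto simp: cover_def layer_edges_def)
    have n: "i \<in> {1..n}" using i by simp
    show ?thesis
    proof (intro set_eqI iffI)
      fix v assume "v \<in> \<Union>(cover S T Z) \<inter> V"
      then obtain e where e: "e \<in> cover S T Z" "v \<in> e" "v \<in> V" by blast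
      then have "v \<in> node h ` {1..n}" using old_in_edge[of e v] sub by blast
      then obtain k where k: "v = node h k" by blast
      then have "e = lower h k \<or> e = diag h i \<and> k = i" using in_u[of e k] e sub by blast
      then show "v \<in> node h ` (if diag h i \<in> Z then insert i T else T)"
        using e cover_mem[OF Z] k by auto
    next
      fix v assume "v \<in> node h ` (if diag h i \<in> Z then insert i T else T)"
      then obtain k where k: "v = node h k" "k \<in> T \<or> diag h i \<in> Z \<and> k = i" by (auto split: if_splits)
      then have "k \<in> {1..n}" using T n by auto
      then have "v \<in> V" using node_in_V k by simp
      moreover have "(if k \<in> T then lower h k else diag h i) \<in> cover S T Z"
        using cover_mem[OF Z] k by auto
      moreover have "v \<in> (if k \<in> T then lower h k else diag h i)" using k by auto
      ultimately show "v \<in> \<Union>(cover S T Z) \<inter> V" by blast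
    qed
  qed
  have one: "prod w' (lower h ` T \<union> upper h ` ({1..n} - S)) = 1" if "T \<subseteq> {1..n}" for T
  proof (rule prod.neutral, rule ballI)
    fix e assume e: "e \<in> lower h ` T \<union> upper h ` ({1..n} - S)"
    then have "e \<in> N" using that by (auto simp: layer_edges_def)
    then have "e \<notin> E" using EN by blast
    moreover have "e \<noteq> rung h i" "e \<noteq> diag h i"
      using e edge_distinct by (metis UnE imageE)+
    ultimately show "w' e = 1" unfolding w'_def by simp
  qed
  have rd: "rung h i \<notin> E" "diag h i \<notin> E" using EN by (auto simp: layer_edges_def)
  have wrd: "w' (rung h i) = c" "w' (diag h i) = t" using rd by (simp_all add: w'_def)
  have two: "prod w' (cover S T {z}) = w' z" if "T \<subseteq> {1..n}" "z \<in> {rung h i, diag h i}" for T z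
  proof -
    have "finite T" using that(1) finite_subset by blast
    have "prod w' (cover S T {z}) = w' z * prod w' (lower h ` T \<union> upper h ` ({1..n} - S))"
    proof -
      have "z \<notin> lower h ` T \<union> upper h ` ({1..n} - S)"
        using that(2) edge_distinct by (metis UnE imageE insertE singletonD)
      moreover have "finite (lower h ` T \<union> upper h ` ({1..n} - S))" using \<open>finite T\<close> by simp
      ultimately show ?thesis unfolding cover_def by simp
    qed
    then show ?thesis using one[OF that(1)] by simp
  qed
  have s0: "?s (cover S S {}) = f S"
    using one[OF S] meet[OF S, of "{}"] unfolding PMw f_def by (simp add: cover_def)
  have s1: "?s (cover S (S - {i, Suc i}) {rung h i}) = c * f (S - {i, Suc i})"
  proof -
    have T: "S - {i, Suc i} \<subseteq> {1..n}" using S by blast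
    show ?thesis using two[OF T, of "rung h i"] meet[OF T, of "{rung h i}"]
      unfolding PMw f_def by (simp add: wrd)
  qed
  have s2: "?s (cover S (S - {Suc i}) {diag h i}) = t * f (insert i (S - {Suc i}))"
  proof -
    have T: "S - {Suc i} \<subseteq> {1..n}" using S by blast
    show ?thesis using two[OF T, of "diag h i"] meet[OF T, of "{diag h i}"]
      unfolding PMw f_def by (simp add: wrd)
  qed
  \<comment> \<open>The sum ranges over a set, so its covers must be distinct. The two with an
    additional edge never occur together: one requires \<open>i \<in> S\<close>, the other
    \<open>i \<notin> S\<close>.\<close>
  have ne: "cover S S {} \<noteq> cover S T {rung h i}" "cover S S {} \<noteq> cover S T {diag h i}" for T
    using cover_mem(3)[of "{}" S S] cover_mem(3)[of "{rung h i}" S T]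
      cover_mem(4)[of "{}" S S] cover_mem(4)[of "{diag h i}" S T] by auto
  show ?thesis
    unfolding sum covers_eq[OF S]
    using s0 s1 s2 ne by auto
qed

end

section \<open>Realising all tables of pair values\<close>

text \<open>Restricting to strip graphs of any height allows the construction to be iterated; each
  layer adds 2 to the height.\<close>

definition realizable :: "nat \<Rightarrow> (nat set \<Rightarrow> complex) \<Rightarrow> bool" where
  "realizable n f \<longleftrightarrow> (\<exists>h V E w. h \<ge> 0 \<and> strip_graph n h V E \<and>
     (\<forall>S\<subseteq>{1..n}. f S = PM (V - node h ` S) {e \<in> E. e \<inter> node h ` S = {}} w))"

lemma realizable_layer:
  assumes f: "realizable n f" and i: "1 \<le> i" "i < n"
  shows "realizable n (\<lambda>S. f S + (if i \<in> S \<and> Suc i \<in> S then c * f (S - {i, Suc i}) else 0)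
      + (if i \<notin> S \<and> Suc i \<in> S then t * f (insert i (S - {Suc i})) else 0))"
proof -
  from f[unfolded realizable_def] obtain h V E w where h: "h \<ge> 0" and G: "strip_graph n h V E"
    and f: "\<And>S. S \<subseteq> {1..n} \<Longrightarrow> f S = PM (V - node h ` S) {e \<in> E. e \<inter> node h ` S = {}} w"
    by auto
  interpret layer n h V E i by unfold_locales fact+
  define w' where "w' = (\<lambda>e. if e \<in> E then w e else if e = rung h i then c else if e = diag h i then t else 1)"
  show ?thesis
    unfolding realizable_def
  proof (rule exI[of _ "h + 2"], rule exI[of _ "V \<union> W"], rule exI[of _ "E \<union> N"], rule exI[of _ w'],
      intro conjI allI impI)
    show "h + 2 \<ge> 0" using h by simp
    show "strip_graph n (h + 2) (V \<union> W) (E \<union> N)" by (rule strip_graph_layer)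
    fix S assume S: "S \<subseteq> {1..n}"
    then have "S - {i, Suc i} \<subseteq> {1..n}" "insert i (S - {Suc i}) \<subseteq> {1..n}" using i by auto
    then show "f S + (if i \<in> S \<and> Suc i \<in> S then c * f (S - {i, Suc i}) else 0)
      + (if i \<notin> S \<and> Suc i \<in> S then t * f (insert i (S - {Suc i})) else 0)
      = PM (V \<union> W - node (h + 2) ` S) {e \<in> E \<union> N. e \<inter> node (h + 2) ` S = {}} w'"
      unfolding w'_def layer_signature[OF S, of w c t] using f S by simp
  qed
qed

text \<open>Disjoint vertical edges with the nodes on top: a missing top node leaves its lower
  neighbour unmatched.\<close>

lemma realizable_vacuum: "realizable n (\<lambda>S. if S = {} then 1 else 0)"
proof -
  define V where "V = node 0 ` {1..n} \<union> node 1 ` {1..n}"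
  define E where "E = lower 0 ` {1..n}"
  have ends: "lower 0 k \<inter> V = {node 0 k, node 1 k}" if "k \<in> {1..n}" for k
    using that by (auto simp: V_def)
  have "strip_graph n 1 V E"
    unfolding strip_graph_def
  proof (intro conjI ballI impI)
    show "finite V" "finite E" by (auto simp: V_def E_def)
    show "node 1 ` {1..n} \<subseteq> V" by (auto simp: V_def)
    show "\<exists>a b. a \<noteq> b \<and> e = closed_segment a b \<and> e \<inter> V = {a,b}" if e: "e \<in> E" for e
    proof -
      obtain k where k: "k \<in> {1..n}" "e = lower 0 k" using e unfolding E_def by blast
      then show ?thesis using ends[OF k(1)]
        by (intro exI[of _ "node 0 k"] exI[of _ "node 1 k"]) (simp add: lower_def)
    qed
    show "e \<inter> e' \<subseteq> V" "e \<inter> V \<noteq> e' \<inter> V" if e: "e \<in> E" "e' \<in> E" "e \<noteq> e'" for e e'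
    proof -
      obtain k k' where k: "k \<in> {1..n}" "e = lower 0 k" "k' \<in> {1..n}" "e' = lower 0 k'"
        using e unfolding E_def by blast
      then have "k \<noteq> k'" using e by auto
      then show "e \<inter> e' \<subseteq> V" "e \<inter> V \<noteq> e' \<inter> V"
        using k ends by (auto simp: mem_lower doubleton_eq_iff)
    qed
    fix z assume "z \<in> V \<union> \<Union>E"
    then obtain k where k: "k \<in> {1..n}" "Re z = real k" "0 \<le> Im z" "Im z \<le> 1"
      by (auto simp: V_def E_def mem_lower)
    then show "1 \<le> Re z" "Re z \<le> real n" "0 \<le> Im z" "Im z \<le> 1" by auto
    assume "Im z = 1"
    then have "z = node 1 k" using k by (simp add: complex_eq_iff)
    then show "z \<in> node 1 ` {1..n}" using k by blast
  qed
  moreover have "(if S = {} then 1 else 0) = PM (V - node 1 ` S) {e \<in> E. e \<inter> node 1 ` S = {}} (\<lambda>_. 1)"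
    if S: "S \<subseteq> {1..n}" for S
  proof (cases "S = {}")
    case True
    have "perfect_matchings V E = {E}"
    proof (intro set_eqI iffI)
      fix M assume "M \<in> perfect_matchings V E"
      then have M: "M \<subseteq> E" "\<forall>v\<in>V. \<exists>!e. e \<in> M \<and> v \<in> e" unfolding perfect_matchings_def by simp_all
      have "lower 0 k \<in> M" if k: "k \<in> {1..n}" for k
      proof -
        have "node 0 k \<in> V" using k by (simp add: V_def)
        then obtain e where "e \<in> M" "node 0 k \<in> e" using M(2) by blast
        then show ?thesis using M(1) by (auto simp: E_def)
      qed
      then show "M \<in> {E}" using M(1) by (auto simp: E_def)
    next
      fix M assume "M \<in> {E}"
      moreover have "\<exists>!e. e \<in> E \<and> v \<in> e" if v: "v \<in> V" for v
      proof -
        obtain k where "k \<in> {1..n}" "v = node 0 k \<or> v = node 1 k" using v by (auto simp: V_def)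
        then show ?thesis by (intro ex1I[of _ "lower 0 k"]) (auto simp: E_def)
      qed
      ultimately show "M \<in> perfect_matchings V E" by (simp add: perfect_matchings_def)
    qed
    then show ?thesis using True by (simp add: PM_def)
  next
    case False
    then obtain k where k: "k \<in> S" by blast
    have "perfect_matchings (V - node 1 ` S) {e \<in> E. e \<inter> node 1 ` S = {}} = {}"
    proof (rule ccontr)
      assume "\<not> ?thesis"
      then obtain M where "M \<in> perfect_matchings (V - node 1 ` S) {e \<in> E. e \<inter> node 1 ` S = {}}" by blast
      then have M: "M \<subseteq> {e \<in> E. e \<inter> node 1 ` S = {}}" "\<forall>v\<in>V - node 1 ` S. \<exists>!e. e \<in> M \<and> v \<in> e"
        unfolding perfect_matchings_def by simp_all
      have "node 0 k \<in> V - node 1 ` S" using k S by (auto simp: V_def)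
      then obtain e where e: "e \<in> M" "node 0 k \<in> e" using M(2) by blast
      then have "e = lower 0 k" "e \<inter> node 1 ` S = {}" using M(1) by (auto simp: E_def)
      moreover have "node 1 k \<in> lower 0 k" by simp
      ultimately show False using k by blast
    qed
    then show ?thesis using False by (simp add: PM_def)
  qed
  ultimately show ?thesis unfolding realizable_def
    by (intro exI[of _ 1] exI[of _ V] exI[of _ E] exI[of _ "\<lambda>_. 1"]) simp
qed

text \<open>The layer with weight \<open>t\<close> on the diagonal adds \<open>t\<close> times row \<open>i\<close> to row \<open>i + 1\<close> of the table of
  pair values, the one with weight \<open>c\<close> on the rung adds \<open>c\<close> to the entry \<open>(i, i + 1)\<close>. The entry
  \<open>(a, j + 1)\<close> is reached by a commutator of a row operation and a change of the entry \<open>(a, j)\<close>.\<close>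

lemma realizable_add_pair:
  assumes "1 \<le> a" "a + Suc d \<le> n" "realizable n f" "f {} = 1"
  shows "\<exists>g. realizable n g \<and> g {} = 1 \<and>
    (\<forall>T. T \<subseteq> {1..n} \<longrightarrow> card T = 2 \<longrightarrow> g T = f T + (if T = {a, a + Suc d} then x else 0))"
  using assms
proof (induction d arbitrary: f x)
  case 0
  \<comment> \<open>A rung of weight \<open>x\<close> is enough here: on the pair
    \<open>{a, Suc a}\<close> it adds \<open>x * f {} = x\<close>, and it changes no other pair
    value.\<close>
  define g where "g S = f S + (if a \<in> S \<and> Suc a \<in> S then x * f (S - {a, Suc a}) else 0)
      + (if a \<notin> S \<and> Suc a \<in> S then 0 * f (insert a (S - {Suc a})) else 0)" for S
  have "realizable n g" unfolding g_def using 0 by (intro realizable_layer) auto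
  moreover have "g {} = 1" using 0 by (simp add: g_def)
  moreover have "g T = f T + (if T = {a, a + Suc 0} then x else 0)" if T: "card T = 2" for T
  proof -
    show ?thesis
    proof (cases "a \<in> T \<and> Suc a \<in> T")
      case True
      then have "T = {a, Suc a}" using T by (auto simp: card_2_iff)
      then show ?thesis using \<open>f {} = 1\<close> by (simp add: g_def)
    next
      case False
      then have "T \<noteq> {a, Suc a}" by blast
      then show ?thesis using False by (simp add: g_def) blast
    qed
  qed
  ultimately show ?case by blast
next
  case (Suc d)
  define j where "j = a + Suc d"
  have j: "1 \<le> j" "j < n" "a < j" using Suc.prems by (auto simp: j_def)
  define row where "row s f' S = f' S + (if j \<in> S \<and> Suc j \<in> S then 0 * f' (S - {j, Suc j}) else 0)
      + (if j \<notin> S \<and> Suc j \<in> S then s * f' (insert j (S - {Suc j})) else 0)"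
    for s :: complex and f' :: "nat set \<Rightarrow> complex" and S
  have row: "realizable n (row s f')" "row s f' {} = 1" if "realizable n f'" "f' {} = 1" for s f'
    using realizable_layer[OF that(1) j(1,2), of 0 s] that(2) by (simp_all add: row_def[abs_def])
  have add: "\<exists>g. realizable n g \<and> g {} = 1 \<and>
    (\<forall>T. T \<subseteq> {1..n} \<longrightarrow> card T = 2 \<longrightarrow> g T = f' T + (if T = {a, j} then y else 0))"
    if "realizable n f'" "f' {} = 1" for f' y
    using Suc.IH[of f' y] that Suc.prems unfolding j_def by simp
  \<comment> \<open>The commutator: add row \<open>j\<close> to row \<open>j + 1\<close>, subtract
    \<open>x\<close> from the entry \<open>(a, j)\<close>, subtract row \<open>j\<close> from row
    \<open>j + 1\<close>, restore the entry. At the second row operation the entry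
    \<open>(a, j)\<close> is smaller by \<open>x\<close> than at the first, which leaves
    \<open>x\<close> in \<open>(a, j + 1)\<close>.\<close>
  obtain f2 where f2: "realizable n f2" "f2 {} = 1"
    "\<And>T. T \<subseteq> {1..n} \<Longrightarrow> card T = 2 \<Longrightarrow> f2 T = row 1 f T + (if T = {a, j} then - x else 0)"
    using add[of "row 1 f" "- x"] row[of f 1] Suc.prems by blast
  obtain g where g: "realizable n g" "g {} = 1"
    "\<And>T. T \<subseteq> {1..n} \<Longrightarrow> card T = 2 \<Longrightarrow> g T = row (- 1) f2 T + (if T = {a, j} then x else 0)"
    using add[of "row (- 1) f2" x] row[of f2 "- 1"] f2 by blast
  have "g T = f T + (if T = {a, Suc j} then x else 0)" if T: "T \<subseteq> {1..n}" "card T = 2" for T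
  proof (cases "j \<notin> T \<and> Suc j \<in> T")
    case True
    define T' where "T' = insert j (T - {Suc j})"
    have "finite T" using T(1) finite_subset by blast
    then have T': "T' \<subseteq> {1..n}" "card T' = 2" "Suc j \<notin> T'"
      using T True j by (auto simp: T'_def card_insert_if)
    have "T' = {a, j} \<longleftrightarrow> T = {a, Suc j}"
    proof
      assume "T' = {a, j}"
      moreover have "T - {Suc j} = T' - {j}" using True unfolding T'_def by blast
      moreover have "{a, j} - {j} = {a}" using j by auto
      ultimately have "T - {Suc j} = {a}" by simp
      then show "T = {a, Suc j}" using True insert_Diff[of "Suc j" T] by (simp add: insert_commute)
    next
      assume "T = {a, Suc j}"
      moreover have "{a, Suc j} - {Suc j} = {a}" using j by auto
      ultimately show "T' = {a, j}" unfolding T'_def by (simp add: insert_commute)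
    qed
    moreover have row_T: "row s f' T = f' T + s * f' T'" "row s f' T' = f' T'" for s f'
      using True T'(3) by (simp_all add: row_def T'_def)
    moreover have "T \<noteq> {a, j}" using True by blast
    ultimately have "f2 T' = f T' + (if T = {a, Suc j} then - x else 0)" "f2 T = f T + f T'"
      "g T = f2 T - f2 T'"
      using f2(3)[OF T'(1,2)] f2(3)[OF T] g(3)[OF T] by simp_all
    then show ?thesis by simp
  next
    case False
    then have r: "row s f' T = f' T" for s f' by (simp add: row_def) blast
    have "T \<noteq> {a, Suc j}" using False j by auto
    then show ?thesis using g(3)[OF T] f2(3)[OF T] by (simp add: r)
  qed
  moreover have "Suc j = a + Suc (Suc d)" by (simp add: j_def)
  ultimately show ?case using g(1,2) by (intro exI[of _ g]) simp
qed

text \<open>\<open>realizable_add_pair\<close> changes a single pair value, so the table is filled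
  one pair at a time, starting from zero.\<close>

lemma realizable_pairs:
  fixes A :: "nat \<Rightarrow> nat \<Rightarrow> complex"
  shows "\<exists>f. realizable n f \<and> f {} = 1 \<and> (\<forall>a b. 1 \<le> a \<longrightarrow> a < b \<longrightarrow> b \<le> n \<longrightarrow> f {a,b} = A a b)"
proof -
  have *: "\<exists>f. realizable n f \<and> f {} = 1 \<and> (\<forall>T. T \<subseteq> {1..n} \<longrightarrow> card T = 2 \<longrightarrow>
      f T = (\<Sum>(a,b)\<in>P. if T = {a,b} then A a b else 0))"
    if "finite P" "P \<subseteq> {(a,b). 1 \<le> a \<and> a < b \<and> b \<le> n}" for P
    using that
  proof (induction P rule: finite_induct)
    case empty
    show ?case
      by (rule exI[of _ "\<lambda>S. if S = {} then 1 else 0"]) (use realizable_vacuum in auto)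
  next
    case (insert p P)
    then obtain f where f: "realizable n f" "f {} = 1" "\<And>T. T \<subseteq> {1..n} \<Longrightarrow> card T = 2 \<Longrightarrow>
      f T = (\<Sum>(a,b)\<in>P. if T = {a,b} then A a b else 0)" by auto
    obtain a b where p: "p = (a,b)" "1 \<le> a" "a < b" "b \<le> n" using insert.prems by (cases p) auto
    then obtain d where d: "b = a + Suc d" by (metis less_iff_Suc_add add_Suc_right)
    obtain g where g: "realizable n g" "g {} = 1" "\<And>T. T \<subseteq> {1..n} \<Longrightarrow> card T = 2 \<Longrightarrow>
        g T = f T + (if T = {a, b} then A a b else 0)"
      using realizable_add_pair[of a d n f "A a b"] p d f by auto
    show ?case
      by (rule exI[of _ g]) (use g f(3) insert.hyps p in \<open>auto simp: add.commute\<close>)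
  qed
  define P where "P = {(a,b). 1 \<le> a \<and> a < b \<and> b \<le> n}"
  have "finite P" by (rule finite_subset[of _ "{..n} \<times> {..n}"]) (auto simp: P_def)
  then obtain f where f: "realizable n f" "f {} = 1" "\<And>T. T \<subseteq> {1..n} \<Longrightarrow> card T = 2 \<Longrightarrow>
      f T = (\<Sum>(a,b)\<in>P. if T = {a,b} then A a b else 0)"
    using *[of P] unfolding P_def by blast
  have "f {a,b} = A a b" if ab: "1 \<le> a" "a < b" "b \<le> n" for a b
  proof -
    have "f {a,b} = (\<Sum>(p,q)\<in>P. if {a,b} = {p,q} then A p q else 0)"
      using ab by (intro f(3)) auto
    \<comment> \<open>As \<open>P\<close> contains sorted pairs only, \<open>(a,b)\<close> is its
      one element that describes the set \<open>{a,b}\<close>.\<close>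
    also have "\<dots> = (\<Sum>x\<in>P. if (a,b) = x then A a b else 0)"
      by (rule sum.cong) (use ab in \<open>auto simp: P_def doubleton_eq_iff split: if_splits\<close>)
    also have "\<dots> = A a b" using \<open>finite P\<close> ab by (simp add: P_def)
    finally show ?thesis .
  qed
  then show ?thesis using f(1,2) by blast
qed

section \<open>Permuted signatures\<close>

lemma matchgate_identities_cong:
  assumes "matchgate_identities r U F" "\<And>S. S \<subseteq> U \<Longrightarrow> F S = G S"
  shows "matchgate_identities r U G"
  unfolding matchgate_identities_def
proof (intro allI impI)
  fix A B assume AB: "A \<subseteq> U" "B \<subseteq> U"
  have "(\<Sum>i\<in>sym_diff A B. (-1) ^ card {k \<in> sym_diff A B. r k < r i} * G (sym_diff A {i}) * G (sym_diff B {i}))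
    = (\<Sum>i\<in>sym_diff A B. (-1) ^ card {k \<in> sym_diff A B. r k < r i} * F (sym_diff A {i}) * F (sym_diff B {i}))"
  proof (rule sum.cong[OF refl])
    fix i assume "i \<in> sym_diff A B"
    then have "sym_diff A {i} \<subseteq> U" "sym_diff B {i} \<subseteq> U" using AB by blast+
    then show "(-1) ^ card {k \<in> sym_diff A B. r k < r i} * G (sym_diff A {i}) * G (sym_diff B {i})
      = (-1) ^ card {k \<in> sym_diff A B. r k < r i} * F (sym_diff A {i}) * F (sym_diff B {i})"
      using assms(2) by simp
  qed
  also have "\<dots> = 0" using assms(1) AB unfolding matchgate_identities_def by blast
  finally show "(\<Sum>i\<in>sym_diff A B. (-1) ^ card {k \<in> sym_diff A B. r k < r i}
    * G (sym_diff A {i}) * G (sym_diff B {i})) = 0" .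
qed

text \<open>Reindexing the sums by \<open>p\<close> replaces the rank of a label by that of its
  image, so \<open>p\<close> itself becomes the order.\<close>

lemma matchgate_identities_permute:
  assumes F: "matchgate_identities id U F" and p: "p permutes U"
  shows "matchgate_identities p U (\<lambda>S. F (p ` S))"
  unfolding matchgate_identities_def
proof (intro allI impI)
  fix A B assume AB: "A \<subseteq> U" "B \<subseteq> U"
  have inj: "inj p" using p by (rule permutes_inj)
  have diff: "p ` sym_diff X Y = sym_diff (p ` X) (p ` Y)" for X Y
    by (simp add: image_Un image_set_diff[OF inj])
  define D where "D = sym_diff A B"
  have pD: "p ` D = sym_diff (p ` A) (p ` B)" by (simp add: D_def diff)
  have "p ` A \<subseteq> U" "p ` B \<subseteq> U" using AB permutes_image[OF p] by blast+
  then have "(\<Sum>i\<in>p ` D. (-1) ^ card {k \<in> p ` D. id k < id i}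
      * F (sym_diff (p ` A) {i}) * F (sym_diff (p ` B) {i})) = 0"
    using F unfolding matchgate_identities_def pD by blast
  also have "(\<Sum>i\<in>p ` D. (-1) ^ card {k \<in> p ` D. id k < id i}
      * F (sym_diff (p ` A) {i}) * F (sym_diff (p ` B) {i}))
    = (\<Sum>i\<in>D. (-1) ^ card {k \<in> D. p k < p i} * F (p ` sym_diff A {i}) * F (p ` sym_diff B {i}))"
  proof (subst sum.reindex)
    show "inj_on p D" using inj by (rule inj_on_subset) simp
    have "card {k \<in> p ` D. id k < id (p i)} = card {k \<in> D. p k < p i}" for i
    proof -
      have "{k \<in> p ` D. id k < id (p i)} = p ` {k \<in> D. p k < p i}" by auto
      then show ?thesis using inj by (simp add: card_image inj_on_subset)
    qed
    then show "sum ((\<lambda>i. (-1) ^ card {k \<in> p ` D. id k < id i}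
        * F (sym_diff (p ` A) {i}) * F (sym_diff (p ` B) {i})) \<circ> p) D
      = (\<Sum>i\<in>D. (-1) ^ card {k \<in> D. p k < p i} * F (p ` sym_diff A {i}) * F (p ` sym_diff B {i}))"
      unfolding diff by simp
  qed
  finally show "(\<Sum>i\<in>sym_diff A B. (-1) ^ card {k \<in> sym_diff A B. p k < p i}
      * F (p ` sym_diff A {i}) * F (p ` sym_diff B {i})) = 0" unfolding D_def .
qed

text \<open>The signs of the ranks alternate. Expanding along the smallest label shows that
  \<open>G\<close> satisfies the relation which the hypothesis demands of the permuted
  signature.\<close>

lemma pfaffian_four:
  assumes F: "matchgate_identities id U F" "F {} = 1" and S: "{a,b,c,d} \<subseteq> U" "a < b" "b < c" "c < (d::nat)"
  shows "F {a,b,c,d} = F {a,b} * F {c,d} - F {a,c} * F {b,d} + F {a,d} * F {b,c}"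
proof -
  let ?S = "{a,b,c,d}"
  have r: "rank_sign id ?S a = 1" "rank_sign id ?S b = -1" "rank_sign id ?S c = 1" "rank_sign id ?S d = -1"
  proof -
    have s: "{k \<in> ?S. id k < id a} = {}" "{k \<in> ?S. id k < id b} = {a}"
      "{k \<in> ?S. id k < id c} = {a,b}" "{k \<in> ?S. id k < id d} = {a,b,c}" using S by auto
    then show "rank_sign id ?S a = 1" "rank_sign id ?S b = -1" "rank_sign id ?S c = 1" "rank_sign id ?S d = -1"
      unfolding rank_sign_def s using S by simp_all
  qed
  have "?S - {a} = {b,c,d}" "?S - {a,b} = {c,d}" "?S - {a,c} = {b,d}" "?S - {a,d} = {b,c}"
    using S by auto
  then show ?thesis
    using pfaffian_expansion[OF F S(1), of a] S r by simp
qed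

lemma card_2_nat_sorted:
  fixes T :: "nat set"
  assumes "card T = 2"
  obtains a b where "a < b" "T = {a,b}"
  using assms unfolding card_2_iff by (metis insert_commute nat_neq_iff)

lemma card_4_nat_sorted:
  fixes T :: "nat set"
  assumes "card T = 4"
  obtains a b c d where "a < b" "b < c" "c < d" "T = {a,b,c,d}"
proof -
  define xs where "xs = sorted_list_of_set T"
  have fin: "finite T" using assms card.infinite by fastforce
  have "length xs = 4" using assms by (simp add: xs_def)
  then obtain a b c d where xs: "xs = [a,b,c,d]"
    by (auto simp: numeral_eq_Suc length_Suc_conv)
  have "sorted_wrt (<) xs" "set xs = T" using fin by (simp_all add: xs_def)
  then show ?thesis using that[of a b c d] unfolding xs by simp
qed

theorem theorem19:
  fixes n :: nat and f :: signature and \<pi> :: "nat \<Rightarrow> nat"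
  assumes "matchgate_signature n f"
    and "normalized n f"
    and "\<pi> permutes {1..n}"
    and "\<forall>a b c d. 1 \<le> a \<and> a < b \<and> b < c \<and> c < d \<and> d \<le> n \<longrightarrow>
           (let F\<pi> = index_expr n (permute_signature \<pi> f) in
              F\<pi> [a, b, c, d] = F\<pi> [a, b] * F\<pi> [c, d] - F\<pi> [a, c] * F\<pi> [b, d] + F\<pi> [a, d] * F\<pi> [b, c])"
  shows "matchgate_signature n (permute_signature \<pi> f)"
proof -
  define F where "F S = f (\<lambda>i\<in>{1..n}. i \<in> S)" for S
  define F' where "F' S = F (\<pi> ` S)" for S
  obtain V E w u where M: "matchgate V E n u" and f: "\<forall>\<alpha> \<in> {1..n} \<rightarrow>\<^sub>E UNIV.
      f \<alpha> = PM (V - u ` {i \<in> {1..n}. \<alpha> i}) {e \<in> E. e \<inter> u ` {i \<in> {1..n}. \<alpha> i} = {}} w"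
    using assms(1) unfolding matchgate_signature_def Let_def by (elim exE conjE)
  have FPM: "PM (V - u ` S) {e \<in> E. e \<inter> u ` S = {}} w = F S" if "S \<subseteq> {1..n}" for S
  proof -
    have "{i \<in> {1..n}. (\<lambda>i\<in>{1..n}. i \<in> S) i} = S" using that by auto
    moreover have "(\<lambda>i\<in>{1..n}. i \<in> S) \<in> {1..n} \<rightarrow>\<^sub>E UNIV" by simp
    ultimately show ?thesis using bspec[OF f, of "\<lambda>i\<in>{1..n}. i \<in> S"] by (simp only: F_def)
  qed
  have F: "matchgate_identities id {1..n} F"
    by (rule matchgate_identities_cong[OF matchgate_signature_identities[OF M] FPM])
  have F0: "F {} = 1" using assms(2) by (simp add: normalized_def F_def)
  have F': "matchgate_identities \<pi> {1..n} F'" "F' {} = 1"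
    unfolding F'_def using matchgate_identities_permute[OF F assms(3)] F0 by simp_all
  have index: "index_expr n (permute_signature \<pi> f) bs = F' (set bs)" for bs
    unfolding index_expr_permute_signature[OF assms(3)] by (simp only: index_expr_def F_def F'_def set_map)
  obtain G where G: "realizable n G" "G {} = 1"
    "\<And>a b. 1 \<le> a \<Longrightarrow> a < b \<Longrightarrow> b \<le> n \<Longrightarrow> G {a,b} = F' {a,b}"
    using realizable_pairs[of n "\<lambda>a b. F' {a,b}"] by blast
  from G(1)[unfolded realizable_def] obtain h V' E' w' where h: "h \<ge> 0" "strip_graph n h V' E'"
    and GPM: "\<And>S. S \<subseteq> {1..n} \<Longrightarrow> PM (V' - node h ` S) {e \<in> E'. e \<inter> node h ` S = {}} w' = G S"
    by auto
  have M': "matchgate V' E' n (node h)" using strip_graph_matchgate h by blast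
  have mG: "matchgate_identities id {1..n} G"
    by (rule matchgate_identities_cong[OF matchgate_signature_identities[OF M'] GPM])
  have agree: "F' S = G S" if "S \<subseteq> {1..n}" for S
  proof (rule agree_on_all_sets[OF F' mG G(2) _ _ _ _ that])
    show "inj_on \<pi> {1..n}" using permutes_inj_on[OF assms(3)] .
    fix T assume T: "T \<subseteq> {1..n}" "card T = 2 \<or> card T = 4"
    then consider "card T = 2" | "card T = 4" by blast
    then show "F' T = G T"
    proof cases
      case 1
      then obtain a b where "a < b" "T = {a,b}" by (rule card_2_nat_sorted)
      then show ?thesis using G(3)[of a b] T(1) by simp
    next
      case 2
      then obtain a b c d where abcd: "a < b" "b < c" "c < d" "T = {a,b,c,d}" by (rule card_4_nat_sorted)
      then have le: "1 \<le> a" "1 \<le> b" "1 \<le> c" "b \<le> n" "c \<le> n" "d \<le> n" using T(1) by auto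
      have "F' {a,b,c,d} = F' {a,b} * F' {c,d} - F' {a,c} * F' {b,d} + F' {a,d} * F' {b,c}"
        using assms(4)[rule_format, of a b c d] abcd le by (simp add: Let_def index)
      also have "\<dots> = G {a,b} * G {c,d} - G {a,c} * G {b,d} + G {a,d} * G {b,c}"
        using abcd le by (simp add: G(3))
      also have "\<dots> = G {a,b,c,d}"
        using pfaffian_four[OF mG G(2), of a b c d] T(1) abcd by simp
      finally show ?thesis using abcd by simp
    qed
  qed auto
  show ?thesis
    unfolding matchgate_signature_def Let_def
  proof (intro exI conjI ballI)
    show "matchgate V' E' n (node h)" by (fact M')
    fix \<alpha> :: "nat \<Rightarrow> bool" assume \<alpha>: "\<alpha> \<in> {1..n} \<rightarrow>\<^sub>E UNIV"
    define S where "S = {i \<in> {1..n}. \<alpha> i}"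
    have S: "S \<subseteq> {1..n}" by (auto simp: S_def)
    \<comment> \<open>Equality is needed as functions: outside \<open>{1..n}\<close> both sides are
      \<open>undefined\<close>, because \<open>\<alpha>\<close> is extensional and
      \<open>inv \<pi>\<close> maps no point from outside into \<open>{1..n}\<close>.\<close>
    have "\<alpha> \<circ> inv \<pi> = (\<lambda>i\<in>{1..n}. i \<in> \<pi> ` S)"
    proof
      fix j
      have j: "inv \<pi> j \<in> {1..n} \<longleftrightarrow> j \<in> {1..n}"
        using permutes_in_image[OF permutes_inv[OF assms(3)]] .
      have "j \<in> \<pi> ` S \<longleftrightarrow> inv \<pi> j \<in> S"
        using permutes_inverses[OF assms(3)] by (metis imageE imageI)
      then show "(\<alpha> \<circ> inv \<pi>) j = (\<lambda>i\<in>{1..n}. i \<in> \<pi> ` S) j"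
        using j PiE_arb[OF \<alpha>, of "inv \<pi> j"] by (simp add: S_def) blast
    qed
    then have "permute_signature \<pi> f \<alpha> = F' S"
      by (simp only: permute_signature_def F'_def F_def)
    then show "permute_signature \<pi> f \<alpha> = PM (V' - node h ` {i \<in> {1..n}. \<alpha> i})
        {e \<in> E'. e \<inter> node h ` {i \<in> {1..n}. \<alpha> i} = {}} w'"
      using GPM[OF S] agree[OF S] unfolding S_def by simp
  qed
qed

end
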